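(* Let $PV_3$ be the group with generators $\lambda_{12},\lambda_{21},\lambda_{13},\lambda_{31},\lambda_{23},\lambda_{32}$ and the six defining relations $\lambda_{ki}\lambda_{kj}\lambda_{ij}=\lambda_{ij}\lambda_{kj}\lambda_{ki}$ for every ordering $(k,i,j)$ of the three distinct indices $1,2,3$. Put $a_1=\lambda_{13}\lambda_{23}$, $b_1=\lambda_{13}\lambda_{12}$, $a_2=\lambda_{32}\lambda_{31}$, $b_2=\lambda_{21}\lambda_{31}$, $c_1=\lambda_{13}\lambda_{31}$, $c_2=\lambda_{13}$, and let $A_1,B_1,A_2,B_2,C_1,C_2$ be their classes in $\gamma_1(PV_3)/\gamma_2(PV_3)$. Then the associated graded Lie ring $L(PV_3)=\bigoplus_{i\ge1}\gamma_i(PV_3)/\gamma_{i+1}(PV_3)$ is the quotient of the free Lie ring $L(A_1,B_1,A_2,B_2,C_1,C_2)$ on these six generators by the relations $$[A_1,B_1]=0,\quad [A_2,B_2]=0,$$ $$[C_1,B_1]=[A_2,B_1],\quad [C_1,A_1]=[B_2,A_1],\quad [C_1,B_2]=[A_1,B_2],\quad [C_1,A_2]=[B_1,A_2].$$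
   Context: $\gamma_i(G)$ is the lower central series ($\gamma_1(G)=G$, $\gamma_{i+1}(G)=[\gamma_i(G),G]$), and $L(G)$ carries the Lie bracket induced by group commutators; Lie rings are over $\mathbb{Z}$. *)

theory Defs
  imports "HOL-Algebra.Generated_Groups" "HOL-Algebra.Coset"
begin

text \<open>A word is a list of letters (b, x); (True, x) stands for x, (False, x) for x inverse.\<close>
type_synonym 'g word = "(bool \<times> 'g) list"

definition inv_word :: "'g word \<Rightarrow> 'g word" where
  "inv_word w = rev (map (\<lambda>(b, x). (\<not> b, x)) w)"

inductive pres_rel :: "'g word set \<Rightarrow> 'g word \<Rightarrow> 'g word \<Rightarrow> bool" for R where
  refl: "pres_rel R w w"
| sym: "pres_rel R u w \<Longrightarrow> pres_rel R w u"
| trans: "pres_rel R u v \<Longrightarrow> pres_rel R v w \<Longrightarrow> pres_rel R u w"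
| cancel: "pres_rel R (u @ [(b, x), (\<not> b, x)] @ v) (u @ v)"
| relator: "r \<in> R \<Longrightarrow> pres_rel R (u @ r @ v) (u @ v)"

definition word_class :: "'g set \<Rightarrow> 'g word set \<Rightarrow> 'g word \<Rightarrow> 'g word set" where
  "word_class S R v = {w. set w \<subseteq> UNIV \<times> S \<and> pres_rel R v w}"

definition presented_group :: "'g set \<Rightarrow> 'g word set \<Rightarrow> 'g word set monoid" where
  "presented_group S R =
     \<lparr> carrier = {word_class S R v | v. set v \<subseteq> UNIV \<times> S},
       mult = (\<lambda>P Q. {w. set w \<subseteq> UNIV \<times> S \<and> (\<exists>x\<in>P. \<exists>y\<in>Q. pres_rel R (x @ y) w)}),
       one = word_class S R [] \<rparr>"

definition gen_elem :: "'g set \<Rightarrow> 'g word set \<Rightarrow> 'g \<Rightarrow> 'g word set" where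
  "gen_elem S R x = word_class S R [(True, x)]"

definition PV3_gens :: "(nat \<times> nat) set" where
  "PV3_gens = {(i, j). i \<in> {1,2,3} \<and> j \<in> {1,2,3} \<and> i \<noteq> j}"

definition PV3_rels :: "(nat \<times> nat) word set" where
  "PV3_rels = {[(True,(k,i)), (True,(k,j)), (True,(i,j))] @
                inv_word [(True,(i,j)), (True,(k,j)), (True,(k,i))]
              | k i j. {k, i, j} = {1, 2, 3} \<and> distinct [k, i, j]}"

definition PV3 :: "(nat \<times> nat) word set monoid" where
  "PV3 = presented_group PV3_gens PV3_rels"

definition lam :: "nat \<Rightarrow> nat \<Rightarrow> (nat \<times> nat) word set" where
  "lam i j = gen_elem PV3_gens PV3_rels (i, j)"

definition gcomm :: "('a, 'b) monoid_scheme \<Rightarrow> 'a \<Rightarrow> 'a \<Rightarrow> 'a" where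
  "gcomm G x y = inv\<^bsub>G\<^esub> x \<otimes>\<^bsub>G\<^esub> inv\<^bsub>G\<^esub> y \<otimes>\<^bsub>G\<^esub> x \<otimes>\<^bsub>G\<^esub> y"

text \<open>lcs G n = gamma_n(G) for n \<ge> 1 (gamma_1 = G); lcs G 0 = G as well (unused).\<close>
primrec lcs :: "('a, 'b) monoid_scheme \<Rightarrow> nat \<Rightarrow> 'a set" where
  "lcs G 0 = carrier G"
| "lcs G (Suc n) = (if n = 0 then carrier G
     else generate G {gcomm G x y | x y. x \<in> lcs G n \<and> y \<in> carrier G})"

record 'a liering =
  lcarrier :: "'a set"
  ladd :: "'a \<Rightarrow> 'a \<Rightarrow> 'a"
  lzero :: 'a
  lbr :: "'a \<Rightarrow> 'a \<Rightarrow> 'a"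

definition additive_group :: "('a, 'b) liering_scheme \<Rightarrow> 'a monoid" where
  "additive_group L = \<lparr> carrier = lcarrier L, mult = ladd L, one = lzero L \<rparr>"

definition lie_ring :: "('a, 'b) liering_scheme \<Rightarrow> bool" where
  "lie_ring L \<longleftrightarrow>
     comm_group (additive_group L) \<and>
     (\<forall>x\<in>lcarrier L. \<forall>y\<in>lcarrier L. lbr L x y \<in> lcarrier L) \<and>
     (\<forall>x\<in>lcarrier L. \<forall>y\<in>lcarrier L. \<forall>z\<in>lcarrier L.
        lbr L (ladd L x y) z = ladd L (lbr L x z) (lbr L y z) \<and>
        lbr L z (ladd L x y) = ladd L (lbr L z x) (lbr L z y)) \<and>
     (\<forall>x\<in>lcarrier L. lbr L x x = lzero L) \<and>
     (\<forall>x\<in>lcarrier L. \<forall>y\<in>lcarrier L. \<forall>z\<in>lcarrier L.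
        ladd L (ladd L (lbr L x (lbr L y z)) (lbr L y (lbr L z x))) (lbr L z (lbr L x y))
          = lzero L)"

definition lie_hom :: "('a, 'c) liering_scheme \<Rightarrow> ('b, 'd) liering_scheme \<Rightarrow> ('a \<Rightarrow> 'b) \<Rightarrow> bool" where
  "lie_hom L M h \<longleftrightarrow>
     (\<forall>x\<in>lcarrier L. h x \<in> lcarrier M) \<and>
     (\<forall>x\<in>lcarrier L. \<forall>y\<in>lcarrier L. h (ladd L x y) = ladd M (h x) (h y)) \<and>
     (\<forall>x\<in>lcarrier L. \<forall>y\<in>lcarrier L. h (lbr L x y) = lbr M (h x) (h y))"

text \<open>An element of L(G) = direct sum over n \<ge> 1 of gamma_n/gamma_(n+1) is a function f with
  f n a coset of gamma_(n+1) in gamma_n for each n \<ge> 1, f 0 = {} (dummy), and f n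
  the zero coset for all but finitely many n.\<close>

definition lcs_quot :: "('a, 'b) monoid_scheme \<Rightarrow> nat \<Rightarrow> 'a set set" where
  "lcs_quot G n = {lcs G (Suc n) #>\<^bsub>G\<^esub> x | x. x \<in> lcs G n}"

definition coset_rep :: "'a set \<Rightarrow> 'a" where
  "coset_rep C = (SOME x. x \<in> C)"

definition assoc_graded :: "('a, 'b) monoid_scheme \<Rightarrow> (nat \<Rightarrow> 'a set) liering" where
  "assoc_graded G =
    \<lparr> lcarrier = {f. f 0 = {} \<and> (\<forall>n\<ge>1. f n \<in> lcs_quot G n)
                     \<and> finite {n. n \<ge> 1 \<and> f n \<noteq> lcs G (Suc n)}},
      ladd = (\<lambda>f g n. if n = 0 then {} else f n <#>\<^bsub>G\<^esub> g n),
      lzero = (\<lambda>n. if n = 0 then {} else lcs G (Suc n)),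
      lbr = (\<lambda>f g n. if n = 0 then {} else
               lcs G (Suc n) #>\<^bsub>G\<^esub>
                 foldr (\<lambda>i acc. gcomm G (coset_rep (f i)) (coset_rep (g (n - i))) \<otimes>\<^bsub>G\<^esub> acc)
                   [1..<n] \<one>\<^bsub>G\<^esub>) \<rparr>"

definition deg1_class :: "('a, 'b) monoid_scheme \<Rightarrow> 'a \<Rightarrow> nat \<Rightarrow> 'a set" where
  "deg1_class G x = (\<lambda>n. if n = 0 then {} else if n = 1 then lcs G 2 #>\<^bsub>G\<^esub> x
                         else lcs G (Suc n))"

definition PV3_lie_rels :: "('a, 'b) liering_scheme \<Rightarrow> 'a \<Rightarrow> 'a \<Rightarrow> 'a \<Rightarrow> 'a \<Rightarrow> 'a \<Rightarrow> 'a \<Rightarrow> bool" where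
  "PV3_lie_rels L a1 b1 a2 b2 c1 c2 \<longleftrightarrow>
     lbr L a1 b1 = lzero L \<and> lbr L a2 b2 = lzero L \<and>
     lbr L c1 b1 = lbr L a2 b1 \<and> lbr L c1 a1 = lbr L b2 a1 \<and>
     lbr L c1 b2 = lbr L a1 b2 \<and> lbr L c1 a2 = lbr L b1 a2"

end

theory Submission
  imports Defs "HOL-Computational_Algebra.Formal_Power_Series" "HOL-Library.Countable" "HOL-Library.Groups_Big_Fun"
begin

text \<open>With u = b2 c1^-1 b1 the relations of the group become: a1 and a2 act on the free group F(b1, b2, u) by
  automorphisms that conjugate the generators, so that the group is the free product of
  F(b1, b2, u) extended by F(a1, a2) with the infinite cyclic group generated by c2. The same change of variables
  turns the presented Lie ring g into the corresponding semidirect product of free Lie rings. The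
  obvious homomorphism from g to the associated graded Lie ring is onto because the latter is generated
  in degree 1. For injectivity, the group is represented by power series with constant term 1 over
  endomorphism rings: a free generator x acts by 1 + t R_x, where R is the regular representation of a
  free associative ring, and a1, a2 act by operators that intertwine the given automorphisms. The leading
  coefficients of such a representation form a representation of the associated graded Lie ring, and its
  composite with g is faithful because free Lie rings embed into free associative rings; the latter
  is shown over the integers by Lazard elimination.\<close>

section \<open>Lie rings and Lie terms\<close>

text \<open>The element u is chosen because b1 and b2 c1^-1 commute with a1, while b2 and c1^-1 b1
  commute with a2, so that u = b2 c1^-1 b1 commutes with both. What remains of the six relations is
  that a1 fixes b1 and u and conjugates b2, and that a2 fixes b2 and u and conjugates b1. The
  obstacle is injectivity: the quotients of the lower central series could be smaller than expected,
  and only homomorphisms out of the group bound them from below. Such a homomorphism only has to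
  satisfy the relations. An action that is trivial modulo the series variable is implemented on the
  regular representation by an operator series with constant term 1, so a1 and a2 become unipotent
  like the other generators. The coefficients of these operators may satisfy relations of their own,
  so a Lie element in a1 and a2 alone could be lost; a second representation, in which b1, b2, u and
  c2 become 1, detects it.\<close>

class lie = ab_group_add +
  fixes br :: "'a \<Rightarrow> 'a \<Rightarrow> 'a"
  assumes br_add_left: "br (x + y) z = br x z + br y z"
    and br_add_right: "br z (x + y) = br z x + br z y"
    and br_self [simp]: "br x x = 0"
    and br_jacobi: "br x (br y z) + br y (br z x) + br z (br x y) = 0"
begin

lemma br_zero_left [simp]: "br 0 x = 0"
  using br_add_left [of 0 0 x] by simp

lemma br_zero_right [simp]: "br x 0 = 0"
  using br_add_right [of x 0 0] by simp

lemma br_minus_left: "br (- x) y = - br x y"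
  using br_add_left [of x "- x" y] by (simp add: eq_neg_iff_add_eq_0 add.commute)

lemma br_minus_right: "br y (- x) = - br y x"
  using br_add_right [of y x "- x"] by (simp add: eq_neg_iff_add_eq_0 add.commute)

lemma br_anti: "br x y = - br y x"
  using br_self [of "x + y"]
  by (simp add: br_add_left br_add_right eq_neg_iff_add_eq_0 del: br_self)
    (simp add: add.commute)

lemma br_leibniz: "br (br x y) z = br (br x z) y + br x (br y z)"
proof -
  have "br x (br y z) - br (br x y) z + br (br x z) y = 0"
    using br_jacobi [of x y z]
    by (metis add_diff_eq add.commute br_anti br_minus_right diff_minus_eq_add
        uminus_add_conv_diff add.left_commute)
  then show ?thesis by (simp add: algebra_simps)
qed

lemma br_leibniz': "br x (br y z) = br (br x y) z - br (br x z) y"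
  using br_leibniz [of x y z] by (simp add: algebra_simps)

end

text \<open>The free Lie ring is never built. A term stands for an element of it, and vanishing
  there is expressed by evaluating to zero under all assignments into Lie rings.\<close>

datatype 'a lterm = LZ | LV 'a | LN "'a lterm" | LP "'a lterm" "'a lterm" | LB "'a lterm" "'a lterm"

primrec ev :: "('a \<Rightarrow> 'l::lie) \<Rightarrow> 'a lterm \<Rightarrow> 'l" where
  "ev m LZ = 0"
| "ev m (LV x) = m x"
| "ev m (LN t) = - ev m t"
| "ev m (LP t s) = ev m t + ev m s"
| "ev m (LB t s) = br (ev m t) (ev m s)"

lemma ev_map: "ev m (map_lterm f t) = ev (m \<circ> f) t"
  by (induction t) auto

lemma ev_cong: "(\<And>x. x \<in> set_lterm t \<Longrightarrow> m x = m' x) \<Longrightarrow> ev m t = ev m' t"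
  by (induction t) auto

lemma ev_zero [simp]: "ev (\<lambda>_. 0) t = 0"
  by (induction t) auto

section \<open>Elimination\<close>

primrec der :: "('x \<Rightarrow> 'x lterm) \<Rightarrow> 'x lterm \<Rightarrow> 'x lterm" where
  "der \<delta> LZ = LZ"
| "der \<delta> (LV x) = \<delta> x"
| "der \<delta> (LN t) = LN (der \<delta> t)"
| "der \<delta> (LP t s) = LP (der \<delta> t) (der \<delta> s)"
| "der \<delta> (LB t s) = LP (LB (der \<delta> t) s) (LB t (der \<delta> s))"

text \<open>The action is from the right, following [t, [d, e]] = [[t, d], e] - [[t, e], d]; hence
  \<open>d\<close> is applied first in the positive summand.\<close>

primrec act :: "('y \<Rightarrow> 'x \<Rightarrow> 'x lterm) \<Rightarrow> 'y lterm \<Rightarrow> 'x lterm \<Rightarrow> 'x lterm" where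
  "act \<delta> LZ t = LZ"
| "act \<delta> (LV y) t = der (\<delta> y) t"
| "act \<delta> (LN d) t = LN (act \<delta> d t)"
| "act \<delta> (LP d e) t = LP (act \<delta> d t) (act \<delta> e t)"
| "act \<delta> (LB d e) t = LP (act \<delta> e (act \<delta> d t)) (LN (act \<delta> d (act \<delta> e t)))"

text \<open>Normal form in a semidirect product: mixed brackets fall back into the second component
  through \<open>act\<close>. A generator may be sent to a whole term rather than a letter, because
  c1 is not one of the free letters.\<close>

primrec elim :: "('y \<Rightarrow> 'x \<Rightarrow> 'x lterm) \<Rightarrow> ('g \<Rightarrow> 'y + 'x lterm) \<Rightarrow> 'g lterm \<Rightarrow> 'y lterm \<times> 'x lterm" where
  "elim \<delta> sp LZ = (LZ, LZ)"
| "elim \<delta> sp (LV g) = (case sp g of Inl y \<Rightarrow> (LV y, LZ) | Inr s \<Rightarrow> (LZ, s))"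
| "elim \<delta> sp (LN t) = (LN (fst (elim \<delta> sp t)), LN (snd (elim \<delta> sp t)))"
| "elim \<delta> sp (LP t s) = (LP (fst (elim \<delta> sp t)) (fst (elim \<delta> sp s)),
                          LP (snd (elim \<delta> sp t)) (snd (elim \<delta> sp s)))"
| "elim \<delta> sp (LB t s) = (LB (fst (elim \<delta> sp t)) (fst (elim \<delta> sp s)),
     LP (LB (snd (elim \<delta> sp t)) (snd (elim \<delta> sp s)))
        (LP (act \<delta> (fst (elim \<delta> sp s)) (snd (elim \<delta> sp t)))
            (LN (act \<delta> (fst (elim \<delta> sp t)) (snd (elim \<delta> sp s))))))"

lemma ev_der:
  assumes "\<And>x. br (mx x) z = ev mx (\<delta> x)"
  shows "ev mx (der \<delta> t) = br (ev mx t) z"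
proof (induction t)
  case (LB t s)
  then show ?case by (simp add: br_leibniz [of "ev mx t" "ev mx s" z])
qed (auto simp: assms br_add_left br_minus_left)

lemma ev_act:
  assumes "\<And>x y. br (mx x) (my y) = ev mx (\<delta> y x)"
  shows "ev mx (act \<delta> d t) = br (ev mx t) (ev my d)"
proof (induction d arbitrary: t)
  case (LV y)
  then show ?case by (simp add: ev_der assms)
next
  case (LB d e)
  then show ?case by (simp add: br_leibniz')
qed (auto simp: br_add_right br_minus_right)

lemma ev_elim:
  assumes "\<And>x y. br (mx x) (my y) = ev mx (\<delta> y x)"
  shows "ev (\<lambda>g. case sp g of Inl y \<Rightarrow> my y | Inr s \<Rightarrow> ev mx s) t
         = ev my (fst (elim \<delta> sp t)) + ev mx (snd (elim \<delta> sp t))"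
proof (induction t)
  case (LV g)
  then show ?case by (simp split: sum.split)
next
  case (LB t s)
  then show ?case
    by (simp add: ev_act [where my = my] assms br_add_left br_add_right
        br_anti [of "ev my _" "ev mx _"] algebra_simps)
qed (auto simp: algebra_simps)

section \<open>Additive endomorphisms of integer-valued functions\<close>

text \<open>Functions of infinite support are included, so that matrix coefficients of an arbitrary
  representation are admissible arguments.\<close>

typedef 'w endo =
  "{F :: ('w \<Rightarrow> int) \<Rightarrow> 'w \<Rightarrow> int. \<forall>f g. F (\<lambda>w. f w + g w) = (\<lambda>w. F f w + F g w)}"
  morphisms app Endo
  by (rule exI [of _ id]) auto

setup_lifting type_definition_endo

lemma app_add_arg: "app F (\<lambda>w. f w + g w) = (\<lambda>w. app F f w + app F g w)"
  using app [of F] by auto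

lemma app_zero_arg [simp]: "app F (\<lambda>w. 0) = (\<lambda>w. 0)"
  using app_add_arg [of F "\<lambda>w. 0" "\<lambda>w. 0"] by (simp add: fun_eq_iff)

lemma app_minus_arg: "app F (\<lambda>w. - f w) = (\<lambda>w. - app F f w)"
  using app_add_arg [of F f "\<lambda>w. - f w"]
  by (simp add: fun_eq_iff eq_neg_iff_add_eq_0 add.commute)

lemma app_diff_arg: "app F (\<lambda>w. f w - g w) = (\<lambda>w. app F f w - app F g w)"
  using app_add_arg [of F f "\<lambda>w. - g w"] by (simp add: app_minus_arg)

lemma endo_eqI: "(\<And>f w. app F f w = app G f w) \<Longrightarrow> F = G"
  by (simp add: app_inject [symmetric] fun_eq_iff)

instantiation endo :: (type) ring_1
begin

lift_definition zero_endo :: "'a endo" is "\<lambda>f w. 0" by simp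
lift_definition one_endo :: "'a endo" is "\<lambda>f. f" by simp
lift_definition plus_endo :: "'a endo \<Rightarrow> 'a endo \<Rightarrow> 'a endo" is "\<lambda>F G f w. F f w + G f w"
  by (simp add: algebra_simps)
lift_definition minus_endo :: "'a endo \<Rightarrow> 'a endo \<Rightarrow> 'a endo" is "\<lambda>F G f w. F f w - G f w"
  by (simp add: algebra_simps)
lift_definition uminus_endo :: "'a endo \<Rightarrow> 'a endo" is "\<lambda>F f w. - F f w"
  by simp
lift_definition times_endo :: "'a endo \<Rightarrow> 'a endo \<Rightarrow> 'a endo" is "\<lambda>F G f. F (G f)"
  by simp

lemmas app_simps [simp] = zero_endo.rep_eq one_endo.rep_eq plus_endo.rep_eq
  minus_endo.rep_eq uminus_endo.rep_eq times_endo.rep_eq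

instance
proof
  show "(0 :: 'a endo) \<noteq> 1"
  proof
    assume "(0 :: 'a endo) = 1"
    then have "app (0 :: 'a endo) (\<lambda>_. 1) = app 1 (\<lambda>_. 1)" by simp
    then show False by (simp add: fun_eq_iff)
  qed
qed (auto intro!: endo_eqI simp: algebra_simps app_add_arg)

end

lemma app_sum: "app (sum F A) f w = (\<Sum>i\<in>A. app (F i) f w)"
  by (induction A rule: infinite_finite_induct) auto

instantiation endo :: (type) lie
begin

definition br_endo :: "'a endo \<Rightarrow> 'a endo \<Rightarrow> 'a endo" where
  "br_endo x y = x * y - y * x"

instance
  by standard (simp_all add: br_endo_def algebra_simps)

end

text \<open>Translation on the right, so that RT a * RT b is the translation by [a, b].\<close>
lift_definition RT :: "'a \<Rightarrow> 'a list endo" is "\<lambda>a f w. f (w @ [a])"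
  by (simp add: fun_eq_iff)

lemma app_RT [simp]: "app (RT a) f w = f (w @ [a])"
  by (simp add: RT.rep_eq)

text \<open>Matrix coefficients intertwine an arbitrary representation with RT, which makes RT universal.\<close>
lemma app_ev_RT_coeff:
  "app (ev RT t) (\<lambda>w. app (prod_list (map \<rho> w)) v x) =
   (\<lambda>u. app (prod_list (map \<rho> u)) (app (ev \<rho> t) v) x)"
proof (induction t arbitrary: v)
  case (LB t s)
  show ?case
    by (simp add: br_endo_def LB.IH app_diff_arg fun_eq_iff)
qed (auto simp: fun_eq_iff app_add_arg app_minus_arg)

lemma ev_RT_universal:
  fixes \<rho> :: "'a \<Rightarrow> 'w endo"
  assumes "ev RT t = 0"
  shows "ev \<rho> t = 0"
proof (rule endo_eqI)
  fix v x
  \<comment> \<open>At the empty word the product of operators is 1, so the matrix coefficient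
    returns the operator itself.\<close>
  have "app (ev \<rho> t) v x = app (ev RT t) (\<lambda>w. app (prod_list (map \<rho> w)) v x) []"
    by (simp add: app_ev_RT_coeff)
  then show "app (ev \<rho> t) v x = app 0 v x" by (simp add: assms)
qed


unbundle fps_syntax

section \<open>Intertwining operators\<close>

text \<open>Read at a word ending in a, the equation \<open>RT a * \<rho> = \<rho> * P a\<close>
  determines the value of \<rho> there from values at the shorter word. This is the recursion, with
  words reversed so that the last letter is peeled off first; at the empty word \<rho> is taken to
  be the identity.\<close>

primrec itw :: "('a \<Rightarrow> 'a list endo fps) \<Rightarrow> 'a list \<Rightarrow> nat \<Rightarrow> ('a list \<Rightarrow> int) \<Rightarrow> int" where
  "itw P [] n f = (if n = 0 then f [] else 0)"
| "itw P (a # w) n f = (\<Sum>i=0..n. itw P w i (app (P a $ (n - i)) f))"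

lemma itw_add: "itw P w n (\<lambda>v. f v + g v) = itw P w n f + itw P w n g"
  by (induction w arbitrary: n f g) (auto simp: app_add_arg sum.distrib)

lift_definition itw_coeff :: "('a \<Rightarrow> 'a list endo fps) \<Rightarrow> nat \<Rightarrow> 'a list endo" is
  "\<lambda>P n f w. itw P (rev w) n f"
  by (simp add: itw_add)

lemma itw_0:
  assumes "\<And>a. P a $ 0 = RT a"
  shows "itw P w 0 f = f (rev w)"
  by (induction w arbitrary: f) (auto simp: assms)

text \<open>Words are free, so the recursion meets no consistency condition: every deformation of
  the regular representation is intertwined with it by a series with constant term 1.\<close>

lemma ex_intertwiner:
  assumes "\<And>a. P a $ 0 = RT a"
  shows "\<exists>\<rho>. \<rho> $ 0 = 1 \<and> (\<forall>a. fps_const (RT a) * \<rho> = \<rho> * P a)"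
proof (intro exI conjI allI)
  show "Abs_fps (itw_coeff P) $ 0 = 1"
    by (rule endo_eqI) (simp add: itw_coeff.rep_eq itw_0 assms)
  show "fps_const (RT a) * Abs_fps (itw_coeff P) = Abs_fps (itw_coeff P) * P a" for a
  proof (rule fps_ext, rule endo_eqI)
    show "app ((fps_const (RT a) * Abs_fps (itw_coeff P)) $ n) f w
        = app ((Abs_fps (itw_coeff P) * P a) $ n) f w" for n f w
      unfolding fps_mult_left_const_nth
      by (simp add: fps_mult_nth app_sum itw_coeff.rep_eq)
  qed
qed

text \<open>The linear coefficient of an intertwiner is a derivation. Deforming \<open>RT a\<close>
  by \<delta> a in first order therefore yields an operator with prescribed brackets.\<close>

lemma ex_derivation: "\<exists>D. \<forall>a. br (RT a) D = \<delta> a"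
proof -
  define P where "P a = fps_const (RT a) + fps_X * fps_const (\<delta> a)" for a
  have P: "P a $ 0 = RT a" "P a $ 1 = \<delta> a" for a
    by (simp_all add: P_def)
  obtain \<rho> where \<rho>: "\<rho> $ 0 = 1" "\<And>a. fps_const (RT a) * \<rho> = \<rho> * P a"
    using ex_intertwiner [of P] P by blast
  have "br (RT a) (\<rho> $ 1) = \<delta> a" for a
    using arg_cong [OF \<rho>(2), of "\<lambda>f. f $ 1" a]
    by (simp add: fps_mult_nth \<rho>(1) P(2) [unfolded One_nat_def] P br_endo_def algebra_simps)
  then show ?thesis by blast
qed

section \<open>The universal representation is faithful on free Lie rings\<close>

text \<open>Among terms in a single letter all brackets vanish, so a term is worth an integer
  multiple of that letter. The integer is kept as a difference of two naturals.\<close>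

primrec cnt :: "'y lterm \<Rightarrow> nat \<times> nat" where
  "cnt LZ = (0, 0)"
| "cnt (LV y) = (1, 0)"
| "cnt (LN t) = (snd (cnt t), fst (cnt t))"
| "cnt (LP t s) = (fst (cnt t) + fst (cnt s), snd (cnt t) + snd (cnt s))"
| "cnt (LB t s) = (0, 0)"

lemma br_ev_const: "br (ev (\<lambda>_. x) s) (ev (\<lambda>_. x) t) = 0"
proof (induction s arbitrary: t)
  case (LV y)
  show ?case
    by (induction t) (auto simp: br_add_right br_minus_right br_leibniz')
next
  case (LB s1 s2)
  then show ?case
    using br_leibniz [of "ev (\<lambda>_. x) s1" "ev (\<lambda>_. x) s2" "ev (\<lambda>_. x) t"] by simp
qed (auto simp: br_add_left br_minus_left)

lemma ev_const:
  "ev (\<lambda>_. x) t = (\<Sum>i<fst (cnt t). x) - (\<Sum>i<snd (cnt t). x)"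
proof -
  have "(\<Sum>i<p + q. x) = (\<Sum>i<p. x) + (\<Sum>i<q. x)" for p q :: nat
    by (induction q) (simp_all add: algebra_simps)
  then show ?thesis
    by (induction t) (simp_all add: br_ev_const algebra_simps)
qed

text \<open>A syntactic upper bound for the weighted degree: cancellation is ignored and a sum
  counts by its heavier summand.\<close>

primrec wt :: "('a \<Rightarrow> nat) \<Rightarrow> 'a lterm \<Rightarrow> nat" where
  "wt w LZ = 0"
| "wt w (LV x) = w x"
| "wt w (LN t) = wt w t"
| "wt w (LP t s) = max (wt w t) (wt w s)"
| "wt w (LB t s) = wt w t + wt w s"

lemma wt_map: "wt w (map_lterm f t) = wt (w \<circ> f) t"
  by (induction t) auto

lemma wt_ge: "x \<in> set_lterm t \<Longrightarrow> w x \<le> wt w t"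
  by (induction t) (auto simp: le_max_iff_disj)

lemma wt_der: "(\<And>x. wt w (\<delta> x) \<le> w x + n) \<Longrightarrow> wt w (der \<delta> t) \<le> wt w t + n"
  by (induction t) (auto simp: nat_add_max_left le_max_iff_disj)

lemma wt_act:
  assumes "\<And>x y. wt w (\<delta> y x) \<le> w x + v y"
  shows "wt w (act \<delta> d t) \<le> wt w t + wt v d"
proof (induction d arbitrary: t)
  case (LV y)
  then show ?case by (simp add: wt_der assms)
next
  case (LP d e)
  have "wt w (act \<delta> d t) \<le> wt w t + wt v d" "wt w (act \<delta> e t) \<le> wt w t + wt v e"
    by (fact LP)+
  then show ?case unfolding act.simps wt.simps nat_add_max_right by (rule max.mono)
next
  case (LB d e)
  have "wt w (act \<delta> e (act \<delta> d t)) \<le> wt w t + (wt v d + wt v e)"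
    using LB(1) [of t] LB(2) [of "act \<delta> d t"] by linarith
  moreover have "wt w (act \<delta> d (act \<delta> e t)) \<le> wt w t + (wt v d + wt v e)"
    using LB(2) [of t] LB(1) [of "act \<delta> e t"] by linarith
  ultimately show ?case by simp
qed simp_all

lemma wt_elim:
  assumes "\<And>x y. wt w (\<delta> y x) \<le> w x + v y"
    and "\<And>g. case sp g of Inl y \<Rightarrow> v y \<le> u g | Inr s \<Rightarrow> wt w s \<le> u g"
  shows "wt v (fst (elim \<delta> sp t)) \<le> wt u t \<and> wt w (snd (elim \<delta> sp t)) \<le> wt u t"
proof (induction t)
  case (LV g)
  show ?case using assms(2) [of g] by (simp split: sum.splits)
next
  case (LP t s)
  then show ?case by (auto intro: max.mono simp del: max.bounded_iff)
next
  case (LB t s)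
  have act: "wt w (act \<delta> d e) \<le> wt w e + wt v d" for d e
    using assms(1) by (rule wt_act)
  have "wt w (act \<delta> (fst (elim \<delta> sp s)) (snd (elim \<delta> sp t))) \<le> wt u t + wt u s"
    using act [of "fst (elim \<delta> sp s)" "snd (elim \<delta> sp t)"] LB by linarith
  moreover have "wt w (act \<delta> (fst (elim \<delta> sp t)) (snd (elim \<delta> sp s))) \<le> wt u t + wt u s"
    using act [of "fst (elim \<delta> sp t)" "snd (elim \<delta> sp s)"] LB by linarith
  ultimately show ?case using LB by (simp add: add_mono)
qed simp_all

lemma set_der: "(\<And>x. x \<in> A \<Longrightarrow> set_lterm (\<delta> x) \<subseteq> A) \<Longrightarrow> set_lterm t \<subseteq> A \<Longrightarrow> set_lterm (der \<delta> t) \<subseteq> A"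
  by (induction t) auto

lemma set_act:
  assumes "\<And>x y. x \<in> A \<Longrightarrow> set_lterm (\<delta> y x) \<subseteq> A" and "set_lterm t \<subseteq> A"
  shows "set_lterm (act \<delta> d t) \<subseteq> A"
  using assms(2) by (induction d arbitrary: t) (simp_all add: set_der assms(1))

lemma set_elim:
  assumes "\<And>x y. x \<in> A \<Longrightarrow> set_lterm (\<delta> y x) \<subseteq> A"
    and "\<forall>g\<in>set_lterm t. \<forall>s. sp g = Inr s \<longrightarrow> set_lterm s \<subseteq> A"
  shows "set_lterm (snd (elim \<delta> sp t)) \<subseteq> A"
  using assms(2)
proof (induction t)
  case (LB t s)
  then have "set_lterm (snd (elim \<delta> sp t)) \<subseteq> A" "set_lterm (snd (elim \<delta> sp s)) \<subseteq> A"
    by (simp_all add: ball_Un)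
  then show ?case by (simp add: set_act assms(1))
qed (auto simp: ball_Un split: sum.split)

lemma ev_eq_zero_if_heavy:
  assumes "\<forall>x\<in>set_lterm t. wt w t < w x"
  shows "ev m t = 0"
proof -
  have "set_lterm t = {}" using assms wt_ge [of _ t w] by fastforce
  then have "ev m t = ev (\<lambda>_. 0) t" by (intro ev_cong) auto
  then show ?thesis by simp
qed

text \<open>Lazard elimination of a letter y of least weight k: the other letters x are replaced by
  (x, j) = [x, y, ..., y], so that there are fewer letters of weight k. Letters that are heavier than
  the whole term do not occur in it.\<close>
lemma ev_RT_faithful_weighted:
  fixes m :: "nat \<Rightarrow> 'l::lie"
  assumes "\<forall>x\<in>set_lterm t. k \<le> w x" "wt w t \<le> N" "0 < k" "ev RT t = 0"
  shows "ev m t = 0"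
  using assms
\<comment> \<open>The outer induction raises the least weight k until it exceeds N; for fixed k the
  inner one lowers the number of letters of weight k.\<close>
proof (induction "Suc N - k" arbitrary: k t w m rule: less_induct)
  case outer: less
  show ?case
    using outer.prems
  proof (induction "card {x\<in>set_lterm t. w x = k}" arbitrary: t w m rule: less_induct)
    case inner: less
    show ?case
    proof (cases "\<exists>y\<in>set_lterm t. w y = k")
      case False
      then have heavy: "\<forall>x\<in>set_lterm t. Suc k \<le> w x"
        using inner.prems(1) by (auto simp: Suc_le_eq order.strict_iff_order)
      show ?thesis
      proof (cases "k \<le> N")
        case True
        then show ?thesis
          using outer.hyps [of "Suc k" t w m] heavy inner.prems by simp
      next
        case False
        then have "\<forall>x\<in>set_lterm t. wt w t < w x"
          using heavy inner.prems(2) by fastforce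
        then show ?thesis by (rule ev_eq_zero_if_heavy)
      qed
    next
      case True
      then obtain y where y: "y \<in> set_lterm t" "w y = k" by blast
      define \<delta> where "\<delta> = (\<lambda>(_::unit) (p::nat \<times> nat). LV (fst p, Suc (snd p)))"
      define sp where "sp x = (if x = y then Inl () else Inr (LV (x, 0::nat)))" for x
      define d t' where "d = fst (elim \<delta> sp t)" and "t' = snd (elim \<delta> sp t)"
      \<comment> \<open>The pair (x, j) weighs as much as x bracketed with j copies of y. Since k is
        positive, only pairs with j = 0 can still have weight k.\<close>
      define w' where "w' p = w (fst p) + snd p * k" for p
      define c where "c p = (\<lambda>z. br z (m y)) ^^ snd p" for p :: "nat \<times> nat"
      define m' where "m' p = c p (m (fst p))" for p
      \<comment> \<open>The Lie ring is left open because three instances are used: one counts y,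
        one carries the vanishing over to \<open>t'\<close>, and one evaluates in the
        target.\<close>
      have elim: "ev (\<lambda>x. if x = y then q else n (x, 0)) t = ev (\<lambda>_. q) d + ev n t'"
        if "\<And>x j. br (n (x, j)) q = n (x, Suc j)" for q :: "'q::lie" and n
      proof -
        have "(\<lambda>x. if x = y then q else n (x, 0)) =
            (\<lambda>x. case sp x of Inl _ \<Rightarrow> q | Inr s \<Rightarrow> ev n s)"
          by (auto simp: sp_def)
        moreover have "br (n p) q = ev n (\<delta> u p)" for p u
          using that [of "fst p" "snd p"] by (simp add: \<delta>_def)
        ultimately show ?thesis
          unfolding d_def t'_def using ev_elim [of n "\<lambda>_. q" \<delta> sp t] by simp
      qed
      \<comment> \<open>Sending y to 1 and all other letters to 0 turns the term into a multiple of
        the identity. Universality makes it vanish, so the multiplicity of y is zero.\<close>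
      have "ev (\<lambda>_. 1 :: unit endo) d = 0"
      proof -
        have "ev (\<lambda>x. if x = y then 1 else 0) t = (0 :: unit endo)"
          by (rule ev_RT_universal) (rule inner.prems)
        then show ?thesis
          using elim [of "\<lambda>_. 0" "1 :: unit endo"] by (simp add: br_endo_def)
      qed
      then have "app (\<Sum>i<fst (cnt d). 1 :: unit endo) (\<lambda>_. 1) () =
          app (\<Sum>i<snd (cnt d). 1 :: unit endo) (\<lambda>_. 1) ()"
        unfolding ev_const by simp
      then have cnt: "fst (cnt d) = snd (cnt d)"
        unfolding app_sum by simp
      \<comment> \<open>\<open>D\<close> plays the role of y in the regular representation on the
        new letters: bracketing with it moves (x, j) to (x, j + 1). Sending y to \<open>D\<close>
        shows that the universal value of \<open>t'\<close> vanishes.\<close>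
      obtain D where D: "\<And>p :: nat \<times> nat. br (RT p) D = RT (fst p, Suc (snd p))"
        using ex_derivation [of "\<lambda>p::nat \<times> nat. RT (fst p, Suc (snd p))"] by blast
      have "ev RT t' = 0"
      proof -
        have "ev (\<lambda>x. if x = y then D else RT (x, 0)) t = 0"
          by (rule ev_RT_universal) (rule inner.prems)
        then show ?thesis
          using elim [of RT D] by (simp add: D ev_const cnt)
      qed
      \<comment> \<open>The pairs are encoded as numbers again, since the induction hypothesis
        speaks of terms over \<open>nat\<close>.\<close>
      define t'' where "t'' = map_lterm prod_encode t'"
      have RT'': "ev RT t'' = 0"
        unfolding t''_def ev_map by (rule ev_RT_universal) fact
      have m': "ev m t = ev (m' \<circ> prod_decode) t''"
      proof -
        have "ev m t = ev (\<lambda>x. if x = y then m y else m' (x, 0)) t"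
          by (rule ev_cong) (simp add: m'_def c_def)
        also have "\<dots> = ev (\<lambda>_. m y) d + ev m' t'"
          by (rule elim) (simp add: m'_def c_def)
        finally show ?thesis by (simp add: t''_def ev_map comp_def ev_const cnt)
      qed
      have wt'': "wt (w' \<circ> prod_decode) t'' \<le> wt w t"
      proof -
        have "wt w' (snd (elim \<delta> sp t)) \<le> wt w t"
          by (rule wt_elim [where v = "\<lambda>_. k", THEN conjunct2])
            (simp_all add: w'_def \<delta>_def sp_def y(2))
        then show ?thesis by (simp add: t''_def t'_def wt_map comp_def)
      qed
      have set': "set_lterm t' \<subseteq> (set_lterm t - {y}) \<times> UNIV"
        unfolding t'_def by (rule set_elim) (auto simp: \<delta>_def sp_def split: if_splits)
      have light: "{p \<in> set_lterm t'. w' p = k} \<subseteq> (\<lambda>x. (x, 0)) ` ({x \<in> set_lterm t. w x = k} - {y})"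
      proof
        fix p assume p: "p \<in> {p \<in> set_lterm t'. w' p = k}"
        then have "fst p \<in> set_lterm t - {y}" using set' by auto
        moreover from this have "k \<le> w (fst p)" using inner.prems(1) by auto
        ultimately show "p \<in> (\<lambda>x. (x, 0)) ` ({x \<in> set_lterm t. w x = k} - {y})"
          using p \<open>0 < k\<close> by (cases p; cases "snd p") (auto simp: w'_def)
      qed
      have fin: "finite (set_lterm s)" for s :: "nat lterm" by (induction s) auto
      have "{x \<in> set_lterm t''. (w' \<circ> prod_decode) x = k} = prod_encode ` {p \<in> set_lterm t'. w' p = k}"
        by (auto simp: t''_def lterm.set_map)
      then have "card {x \<in> set_lterm t''. (w' \<circ> prod_decode) x = k} = card {p \<in> set_lterm t'. w' p = k}"
        by (simp add: card_image inj_prod_encode)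
      also have "\<dots> \<le> card ((\<lambda>x. (x, 0::nat)) ` ({x \<in> set_lterm t. w x = k} - {y}))"
        using light by (intro card_mono) (auto simp: fin)
      also have "\<dots> \<le> card ({x \<in> set_lterm t. w x = k} - {y})"
        by (rule card_image_le) (simp add: fin)
      also have "\<dots> < card {x \<in> set_lterm t. w x = k}"
        using y by (intro psubset_card_mono) (auto simp: fin)
      finally have "ev (m' \<circ> prod_decode) t'' = 0"
      proof (rule inner.hyps)
        show "\<forall>x\<in>set_lterm t''. k \<le> (w' \<circ> prod_decode) x"
          using set' inner.prems(1) by (fastforce simp: t''_def lterm.set_map w'_def)
        show "wt (w' \<circ> prod_decode) t'' \<le> N"
          using wt'' inner.prems(2) by simp
      qed (fact inner.prems RT'')+
      with m' show ?thesis by simp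
    qed
  qed
qed

text \<open>Countability renames the letters to numbers. All of them start with weight 1, and the
  weight of the term itself serves as the bound.\<close>

lemma ev_RT_faithful:
  fixes m :: "'a::countable \<Rightarrow> 'l::lie"
  assumes "ev RT t = 0"
  shows "ev m t = 0"
proof -
  have "ev (m \<circ> from_nat) (map_lterm to_nat t) = 0"
    by (rule ev_RT_faithful_weighted [where w = "\<lambda>_. 1" and k = 1, OF _ order_refl])
      (auto simp: ev_map intro: ev_RT_universal assms)
  then show ?thesis by (simp add: ev_map comp_def)
qed


section \<open>The lower central series\<close>

context group
begin

text \<open>Together with \<open>word_simps\<close> these rules freely reduce group words, which
  settles identities such as Hall-Witt by simplification.\<close>

lemma inv_l_cancel [simp]:
  assumes "x \<in> carrier G" "y \<in> carrier G"
  shows "inv x \<otimes> (x \<otimes> y) = y" "x \<otimes> (inv x \<otimes> y) = y"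
  using assms by (simp_all flip: m_assoc)

lemmas word_simps = gcomm_def m_assoc inv_mult_group

lemma gcomm_closed [simp]: "x \<in> carrier G \<Longrightarrow> y \<in> carrier G \<Longrightarrow> gcomm G x y \<in> carrier G"
  by (simp add: gcomm_def)

lemma gcomm_conj:
  assumes "x \<in> carrier G" "y \<in> carrier G" "g \<in> carrier G"
  shows "g \<otimes> gcomm G x y \<otimes> inv g = gcomm G (g \<otimes> x \<otimes> inv g) (g \<otimes> y \<otimes> inv g)"
  using assms by (simp add: word_simps)

lemma lcs_1 [simp]: "lcs G (Suc 0) = carrier G"
  by simp

lemma lcs_Suc: "0 < n \<Longrightarrow> lcs G (Suc n) = generate G {gcomm G x y | x y. x \<in> lcs G n \<and> y \<in> carrier G}"
  by simp

declare lcs.simps(2) [simp del]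

lemma lcs_normal: "lcs G n \<lhd> G"
proof (induction n)
  case 0
  show ?case by (simp add: normal_inv_iff subgroup_self)
next
  case (Suc n)
  interpret N: normal "lcs G n" G by (rule Suc.IH)
  show ?case
  proof (cases "n = 0")
    case True
    then show ?thesis by (simp add: normal_inv_iff subgroup_self)
  next
    case False
    show ?thesis
      unfolding lcs_Suc [OF False [THEN neq0_conv [THEN iffD1]]]
    proof (rule normal_generateI)
      show "{gcomm G x y |x y. x \<in> lcs G n \<and> y \<in> carrier G} \<subseteq> carrier G"
        by auto
    next
      fix h g assume "h \<in> {gcomm G x y |x y. x \<in> lcs G n \<and> y \<in> carrier G}" and g: "g \<in> carrier G"
      then obtain x y where h: "h = gcomm G x y" "x \<in> lcs G n" "y \<in> carrier G" by blast
      then have "g \<otimes> x \<otimes> inv g \<in> lcs G n" "g \<otimes> y \<otimes> inv g \<in> carrier G"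
        using g N.inv_op_closed2 by auto
      then show "g \<otimes> h \<otimes> inv g \<in> {gcomm G x y |x y. x \<in> lcs G n \<and> y \<in> carrier G}"
        using h g by (auto simp: gcomm_conj)
    qed
  qed
qed

lemma lcs_subgroup: "subgroup (lcs G n) G"
  by (simp add: lcs_normal normal_imp_subgroup)

lemma lcs_carrier [simp]: "x \<in> lcs G n \<Longrightarrow> x \<in> carrier G"
  using subgroup.mem_carrier [OF lcs_subgroup] .

lemma lcs_subset_carrier: "lcs G n \<subseteq> carrier G"
  by auto

lemma lcs_mult [simp]: "x \<in> lcs G n \<Longrightarrow> y \<in> lcs G n \<Longrightarrow> x \<otimes> y \<in> lcs G n"
  using subgroup.m_closed [OF lcs_subgroup] .

lemma lcs_inv [simp]: "x \<in> lcs G n \<Longrightarrow> inv x \<in> lcs G n"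
  using subgroup.m_inv_closed [OF lcs_subgroup] .

lemma lcs_one [simp]: "\<one> \<in> lcs G n"
  using subgroup.one_closed [OF lcs_subgroup] .

lemma lcs_conj: "x \<in> lcs G n \<Longrightarrow> g \<in> carrier G \<Longrightarrow> inv g \<otimes> x \<otimes> g \<in> lcs G n"
  using normal.inv_op_closed1 [OF lcs_normal] .

lemma lcs_conj': "x \<in> lcs G n \<Longrightarrow> g \<in> carrier G \<Longrightarrow> g \<otimes> x \<otimes> inv g \<in> lcs G n"
  using normal.inv_op_closed2 [OF lcs_normal] .

lemma lcs_Suc_subset: "lcs G (Suc n) \<subseteq> lcs G n"
proof (cases "n = 0")
  case False
  have "gcomm G x y \<in> lcs G n" if "x \<in> lcs G n" "y \<in> carrier G" for x y
  proof -
    have "gcomm G x y = inv x \<otimes> (inv y \<otimes> x \<otimes> y)"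
      using that by (simp add: word_simps)
    then show ?thesis using that lcs_conj by simp
  qed
  then show ?thesis
    using False by (simp add: lcs_Suc) (rule generate_subgroup_incl [OF _ lcs_subgroup], auto)
qed auto

lemma gcomm_lcs_Suc:
  "x \<in> lcs G n \<Longrightarrow> y \<in> carrier G \<Longrightarrow> 0 < n \<Longrightarrow> gcomm G x y \<in> lcs G (Suc n)"
  by (subst lcs_Suc) (auto intro: generate.incl)

lemma hall_witt:
  assumes "a \<in> carrier G" "b \<in> carrier G" "c \<in> carrier G"
  shows "(inv b \<otimes> gcomm G (gcomm G a (inv b)) c \<otimes> b) \<otimes> (inv c \<otimes> gcomm G (gcomm G b (inv c)) a \<otimes> c)
      \<otimes> (inv a \<otimes> gcomm G (gcomm G c (inv a)) b \<otimes> a) = \<one>"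
  using assms by (simp add: word_simps)

text \<open>Hall-Witt with b replaced by its inverse: now [a, b] itself occurs, which is the shape
  of the generators of the next term of the series.\<close>

lemma hall_witt_inv:
  assumes "a \<in> carrier G" "b \<in> carrier G" "c \<in> carrier G"
  shows "(b \<otimes> gcomm G (gcomm G a b) c \<otimes> inv b) \<otimes> (inv c \<otimes> gcomm G (gcomm G (inv b) (inv c)) a \<otimes> c)
      \<otimes> (inv a \<otimes> gcomm G (gcomm G c (inv a)) (inv b) \<otimes> a) = \<one>"
  using assms by (simp add: word_simps)

lemma gcomm_swap:
  "x \<in> carrier G \<Longrightarrow> y \<in> carrier G \<Longrightarrow> gcomm G y x = inv (gcomm G x y)"
  by (simp add: word_simps)

lemma gcomm_mult_right:
  "x \<in> carrier G \<Longrightarrow> y \<in> carrier G \<Longrightarrow> z \<in> carrier G \<Longrightarrow>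
   gcomm G x (y \<otimes> z) = gcomm G x z \<otimes> (inv z \<otimes> gcomm G x y \<otimes> z)"
  by (simp add: word_simps)

lemma gcomm_mult_left:
  "x \<in> carrier G \<Longrightarrow> y \<in> carrier G \<Longrightarrow> z \<in> carrier G \<Longrightarrow>
   gcomm G (x \<otimes> y) z = (inv y \<otimes> gcomm G x z \<otimes> y) \<otimes> gcomm G y z"
  by (simp add: word_simps)

lemma gcomm_inv_right:
  "x \<in> carrier G \<Longrightarrow> y \<in> carrier G \<Longrightarrow> gcomm G x (inv y) = y \<otimes> inv (gcomm G x y) \<otimes> inv y"
  by (simp add: word_simps)

lemma gcomm_one [simp]:
  "x \<in> carrier G \<Longrightarrow> gcomm G x \<one> = \<one>" "x \<in> carrier G \<Longrightarrow> gcomm G \<one> x = \<one>"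
  by (simp_all add: gcomm_def)

text \<open>For y = [a, b] the Hall-Witt identity expresses [x, y] by conjugates of [[b^-1, x^-1], a] and
  [[x, a^-1], b^-1], which are covered by the induction hypothesis (three subgroups lemma).\<close>
lemma gcomm_lcs:
  assumes "x \<in> lcs G m" "y \<in> lcs G n" "0 < m" "0 < n"
  shows "gcomm G x y \<in> lcs G (m + n)"
  using assms(4,1-3)
proof (induction n arbitrary: m x y rule: nat_induct_non_zero)
  case 1
  then show ?case by (simp add: gcomm_lcs_Suc)
next
  case (Suc n)
  define H where "H = {gcomm G x y | x y. x \<in> lcs G n \<and> y \<in> carrier G}"
  have "y \<in> generate G H" using Suc.prems(2) Suc.hyps by (simp add: lcs_Suc H_def)
  then have "\<forall>x\<in>lcs G m. gcomm G x y \<in> lcs G (m + Suc n)"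
  proof (induction rule: generate.induct)
    case one
    then show ?case by simp
  next
    have base: "gcomm G x h \<in> lcs G (m + Suc n)" if "h \<in> H" and x: "x \<in> lcs G m" for h x
    proof -
      from \<open>h \<in> H\<close> obtain a b where h: "h = gcomm G a b" and a: "a \<in> lcs G n" and b: "b \<in> carrier G"
        unfolding H_def by blast
      define u where "u = b \<otimes> gcomm G h x \<otimes> inv b"
      define v where "v = inv x \<otimes> gcomm G (gcomm G (inv b) (inv x)) a \<otimes> x"
      define w where "w = inv a \<otimes> gcomm G (gcomm G x (inv a)) (inv b) \<otimes> a"
      have "u \<otimes> v \<otimes> w = \<one>"
        unfolding u_def v_def w_def h using a b x by (intro hall_witt_inv) auto
      have "gcomm G (inv b) (inv x) = inv (gcomm G (inv x) (inv b))"
        using b x by (intro gcomm_swap) auto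
      moreover have "gcomm G (inv x) (inv b) \<in> lcs G (Suc m)"
        using b x Suc.prems(3) by (intro gcomm_lcs_Suc) auto
      ultimately have "gcomm G (gcomm G (inv b) (inv x)) a \<in> lcs G (Suc m + n)"
        using a by (intro Suc.IH) auto
      then have v: "v \<in> lcs G (m + Suc n)"
        unfolding v_def using x by (intro lcs_conj) auto
      have "gcomm G x (inv a) \<in> lcs G (m + n)"
        using a x Suc.prems(3) by (intro Suc.IH) auto
      then have "gcomm G (gcomm G x (inv a)) (inv b) \<in> lcs G (Suc (m + n))"
        using b Suc.prems(3) by (intro gcomm_lcs_Suc) auto
      then have w: "w \<in> lcs G (m + Suc n)"
        unfolding w_def using a by (intro lcs_conj) auto
      have hc: "h \<in> carrier G" and uc: "u \<in> carrier G"
        using a b x by (simp_all add: h u_def)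
      have "u = inv (v \<otimes> w)"
        using \<open>u \<otimes> v \<otimes> w = \<one>\<close> v w uc by (intro inv_equality [symmetric]) (simp_all add: m_assoc)
      then have "u \<in> lcs G (m + Suc n)" using v w by (metis lcs_inv lcs_mult)
      then have "inv b \<otimes> u \<otimes> b \<in> lcs G (m + Suc n)" using b by (rule lcs_conj)
      then have "gcomm G h x \<in> lcs G (m + Suc n)"
        using b x hc by (simp add: u_def m_assoc)
      then show ?thesis using x hc gcomm_swap [of h x] by simp
    qed
    have Hc: "h \<in> carrier G" if "h \<in> H" for h using that by (auto simp: H_def)
    {
      case (incl h)
      then show ?case using base by blast
    next
      case (inv h)
      then show ?case using base Hc lcs_conj' by (simp add: gcomm_inv_right)
    next
      case (eng h1 h2)
      moreover have "generate G H \<subseteq> carrier G" using Hc by (intro generate_incl) auto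
      ultimately show ?case
        using lcs_conj by (auto simp: gcomm_mult_right subset_iff)
    }
  qed
  then show ?case using Suc.prems(1) by blast
qed

section \<open>Homogeneous components\<close>

definition cl :: "nat \<Rightarrow> 'a \<Rightarrow> 'a set" where
  "cl n x = lcs G (Suc n) #> x"

lemma cl_mult: "x \<in> carrier G \<Longrightarrow> y \<in> carrier G \<Longrightarrow> cl n x <#> cl n y = cl n (x \<otimes> y)"
  unfolding cl_def by (rule normal.rcos_sum [OF lcs_normal])

lemma cl_eq_iff:
  assumes "x \<in> carrier G" "y \<in> carrier G"
  shows "cl n x = cl n y \<longleftrightarrow> x \<otimes> inv y \<in> lcs G (Suc n)"
proof -
  have "x \<otimes> inv y \<in> lcs G (Suc n) \<longleftrightarrow> x \<in> lcs G (Suc n) #> y"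
    using subgroup.rcos_module [OF lcs_subgroup group_axioms, of y x] assms by simp
  also have "\<dots> \<longleftrightarrow> lcs G (Suc n) #> y = lcs G (Suc n) #> x"
    using assms lcs_subgroup repr_independence rcos_self by metis
  finally show ?thesis by (auto simp: cl_def)
qed

lemma cl_one: "cl n \<one> = lcs G (Suc n)"
  by (simp add: cl_def lcs_subset_carrier coset_mult_one)

lemma cl_eq_one: "x \<in> lcs G (Suc n) \<Longrightarrow> cl n x = cl n \<one>"
  by (subst cl_eq_iff) auto

lemma cl_mult_cong:
  assumes "cl n x = cl n x'" "cl n y = cl n y'"
    and "x \<in> carrier G" "x' \<in> carrier G" "y \<in> carrier G" "y' \<in> carrier G"
  shows "cl n (x \<otimes> y) = cl n (x' \<otimes> y')"
  using assms by (simp flip: cl_mult)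

lemma cl_inv_cong:
  assumes "cl n x = cl n x'" "x \<in> carrier G" "x' \<in> carrier G"
  shows "cl n (inv x) = cl n (inv x')"
proof -
  have "x' \<otimes> inv x \<in> lcs G (Suc n)" using assms by (metis cl_eq_iff)
  then have "inv x' \<otimes> (x' \<otimes> inv x) \<otimes> x' \<in> lcs G (Suc n)" using assms by (intro lcs_conj)
  then show ?thesis using assms by (simp add: cl_eq_iff m_assoc)
qed

lemma cl_conj:
  assumes "x \<in> lcs G n" "g \<in> carrier G" "0 < n"
  shows "cl n (inv g \<otimes> x \<otimes> g) = cl n x"
proof -
  have "gcomm G g (inv x) \<in> lcs G (Suc n)"
    using assms lcs_inv [OF gcomm_lcs_Suc [of "inv x" n g]] gcomm_swap [of "inv x" g] by simp
  then show ?thesis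
    using assms by (simp add: cl_eq_iff gcomm_def)
qed

lemma cl_commute:
  assumes "x \<in> lcs G n" "y \<in> carrier G" "0 < n"
  shows "cl n (x \<otimes> y) = cl n (y \<otimes> x)"
proof -
  have "x \<otimes> y = y \<otimes> (inv y \<otimes> x \<otimes> y)"
    using assms by (simp add: m_assoc)
  also have "cl n \<dots> = cl n (y \<otimes> x)"
    using assms by (intro cl_mult_cong cl_conj) auto
  finally show ?thesis .
qed

lemma cl_gcomm_mult_left:
  assumes "x \<in> lcs G m" "x' \<in> lcs G m" "y \<in> lcs G n" "0 < m" "0 < n"
  shows "cl (m + n) (gcomm G (x \<otimes> x') y) = cl (m + n) (gcomm G x y \<otimes> gcomm G x' y)"
proof -
  have "gcomm G (x \<otimes> x') y = (inv x' \<otimes> gcomm G x y \<otimes> x') \<otimes> gcomm G x' y"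
    using assms by (simp add: gcomm_mult_left)
  also have "cl (m + n) \<dots> = cl (m + n) (gcomm G x y \<otimes> gcomm G x' y)"
    using assms by (intro cl_mult_cong cl_conj gcomm_lcs) auto
  finally show ?thesis .
qed

lemma cl_gcomm_mult_right:
  assumes "x \<in> lcs G m" "y \<in> lcs G n" "y' \<in> lcs G n" "0 < m" "0 < n"
  shows "cl (m + n) (gcomm G x (y \<otimes> y')) = cl (m + n) (gcomm G x y \<otimes> gcomm G x y')"
proof -
  have "cl (m + n) (gcomm G x (y \<otimes> y')) = cl (m + n) (gcomm G x y' \<otimes> gcomm G x y)"
  proof -
    have "gcomm G x (y \<otimes> y') = gcomm G x y' \<otimes> (inv y' \<otimes> gcomm G x y \<otimes> y')"
      using assms by (simp add: gcomm_mult_right)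
    also have "cl (m + n) \<dots> = cl (m + n) (gcomm G x y' \<otimes> gcomm G x y)"
      using assms by (intro cl_mult_cong cl_conj gcomm_lcs) auto
    finally show ?thesis .
  qed
  also have "\<dots> = cl (m + n) (gcomm G x y \<otimes> gcomm G x y')"
    using assms by (intro cl_commute gcomm_lcs) auto
  finally show ?thesis .
qed

lemma cl_gcomm_inv_right:
  assumes "x \<in> lcs G m" "y \<in> lcs G n" "0 < m" "0 < n"
  shows "cl (m + n) (gcomm G x (inv y)) = cl (m + n) (inv (gcomm G x y))"
proof -
  have "gcomm G x (inv y) = inv (inv y) \<otimes> inv (gcomm G x y) \<otimes> inv y"
    using assms by (simp add: gcomm_inv_right)
  also have "cl (m + n) \<dots> = cl (m + n) (inv (gcomm G x y))"
    using assms by (intro cl_conj lcs_inv gcomm_lcs) auto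
  finally show ?thesis .
qed

text \<open>Changing an argument within its coset multiplies it by an element one step deeper, whose
  commutator also lies one step deeper. This makes the bracket independent of
  representatives.\<close>

lemma cl_gcomm_cong:
  assumes "cl m x = cl m x'" "cl n y = cl n y'" "0 < m" "0 < n"
    and "x \<in> lcs G m" "x' \<in> lcs G m" "y \<in> lcs G n" "y' \<in> lcs G n"
  shows "cl (m + n) (gcomm G x y) = cl (m + n) (gcomm G x' y')"
proof -
  define k where "k = x \<otimes> inv x'"
  define l where "l = y \<otimes> inv y'"
  have k: "k \<in> lcs G (Suc m)" "k \<in> lcs G m" "x = k \<otimes> x'"
    using assms by (auto simp: k_def cl_eq_iff m_assoc)
  have l: "l \<in> lcs G (Suc n)" "l \<in> lcs G n" "y = l \<otimes> y'"
    using assms by (auto simp: l_def cl_eq_iff m_assoc)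
  have "cl (m + n) (gcomm G x y) = cl (m + n) (gcomm G k y \<otimes> gcomm G x' y)"
    using assms k cl_gcomm_mult_left by simp
  also have "\<dots> = cl (m + n) (\<one> \<otimes> gcomm G x' y)"
    using assms k gcomm_lcs [of k "Suc m" y n]
    by (intro cl_mult_cong cl_eq_one) auto
  also have "\<dots> = cl (m + n) (gcomm G x' l \<otimes> gcomm G x' y')"
    using assms l cl_gcomm_mult_right by simp
  also have "\<dots> = cl (m + n) (\<one> \<otimes> gcomm G x' y')"
    using assms l gcomm_lcs [of x' m l "Suc n"]
    by (intro cl_mult_cong cl_eq_one) auto
  finally show ?thesis using assms by simp
qed

lemma cl_jacobi:
  assumes x: "x \<in> lcs G l" and y: "y \<in> lcs G m" and z: "z \<in> lcs G n" and pos: "0 < l" "0 < m" "0 < n"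
  shows "cl (l + m + n) (gcomm G x (gcomm G y z) \<otimes> gcomm G y (gcomm G z x) \<otimes> gcomm G z (gcomm G x y)) = cl (l + m + n) \<one>"
proof -
  let ?N = "l + m + n"
  \<comment> \<open>Modulo the next term a Hall-Witt factor loses its outer conjugation; the
    inverted inner argument and the exchange of the outer arguments each contribute a sign, and the
    two signs cancel.\<close>
  have eq: "cl (i + j + k) (inv b \<otimes> gcomm G (gcomm G a (inv b)) c \<otimes> b) = cl (i + j + k) (gcomm G c (gcomm G a b))"
    if abc: "a \<in> lcs G i" "b \<in> lcs G j" "c \<in> lcs G k" and pos: "0 < i" "0 < j" "0 < k" for a b c i j k
  proof -
    have ab: "gcomm G a b \<in> lcs G (i + j)" "gcomm G a (inv b) \<in> lcs G (i + j)"
      using that by (auto intro: gcomm_lcs)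
    then have "cl (i + j + k) (inv b \<otimes> gcomm G (gcomm G a (inv b)) c \<otimes> b) = cl (i + j + k) (gcomm G (gcomm G a (inv b)) c)"
      using that by (intro cl_conj gcomm_lcs) auto
    also have "\<dots> = cl (i + j + k) (inv (gcomm G c (gcomm G a (inv b))))"
      using that ab gcomm_swap [of c "gcomm G a (inv b)"] by simp
    also have "\<dots> = cl (i + j + k) (inv (gcomm G c (inv (gcomm G a b))))"
      using that ab cl_gcomm_cong [of k c c "i + j" "gcomm G a (inv b)" "inv (gcomm G a b)"]
      by (intro cl_inv_cong) (auto simp: cl_gcomm_inv_right ac_simps)
    also have "\<dots> = cl (i + j + k) (inv (inv (gcomm G c (gcomm G a b))))"
      using that ab cl_gcomm_inv_right [of c k "gcomm G a b" "i + j"]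
      by (intro cl_inv_cong) (auto simp: ac_simps)
    finally show ?thesis using that by simp
  qed
  have "cl ?N (gcomm G z (gcomm G x y) \<otimes> gcomm G x (gcomm G y z) \<otimes> gcomm G y (gcomm G z x)) = cl ?N \<one>"
  proof -
    have "cl ?N (gcomm G z (gcomm G x y) \<otimes> gcomm G x (gcomm G y z) \<otimes> gcomm G y (gcomm G z x))
      = cl ?N ((inv y \<otimes> gcomm G (gcomm G x (inv y)) z \<otimes> y)
          \<otimes> (inv z \<otimes> gcomm G (gcomm G y (inv z)) x \<otimes> z)
          \<otimes> (inv x \<otimes> gcomm G (gcomm G z (inv x)) y \<otimes> x))"
      using x y z eq [OF x y z pos] eq [OF y z x pos(2,3,1)] eq [OF z x y pos(3,1,2)]
      by (intro cl_mult_cong) (auto simp: add.commute add.left_commute)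
    then show ?thesis using x y z by (simp only: hall_witt [of x y z] lcs_carrier)
  qed
  moreover have "cl ?N (gcomm G z (gcomm G x y) \<otimes> (gcomm G x (gcomm G y z) \<otimes> gcomm G y (gcomm G z x)))
      = cl ?N (gcomm G x (gcomm G y z) \<otimes> gcomm G y (gcomm G z x) \<otimes> gcomm G z (gcomm G x y))"
    using gcomm_lcs [OF z gcomm_lcs [OF x y]] x y z pos by (intro cl_commute) (auto simp: ac_simps)
  ultimately show ?thesis using x y z by (simp add: m_assoc)
qed

end


section \<open>Bilinear brackets on abelian groups\<close>

text \<open>Alternation and Jacobi are left out, so that computations with sums are available while
  those two laws are still being derived for the graded ring.\<close>

locale bilinear_ring =
  fixes L :: "('a, 'b) liering_scheme"
  assumes additive: "comm_group (additive_group L)"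
    and lbr_closed: "x \<in> lcarrier L \<Longrightarrow> y \<in> lcarrier L \<Longrightarrow> lbr L x y \<in> lcarrier L"
    and lbr_add_left: "x \<in> lcarrier L \<Longrightarrow> y \<in> lcarrier L \<Longrightarrow> z \<in> lcarrier L \<Longrightarrow>
          lbr L (ladd L x y) z = ladd L (lbr L x z) (lbr L y z)"
    and lbr_add_right: "x \<in> lcarrier L \<Longrightarrow> y \<in> lcarrier L \<Longrightarrow> z \<in> lcarrier L \<Longrightarrow>
          lbr L z (ladd L x y) = ladd L (lbr L z x) (lbr L z y)"
begin

sublocale A: comm_group "additive_group L"
  rewrites "carrier (additive_group L) = lcarrier L"
    and "monoid.mult (additive_group L) = ladd L"
    and "one (additive_group L) = lzero L"
  using additive by (simp_all add: additive_group_def)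

definition lneg :: "'a \<Rightarrow> 'a" where
  "lneg x = inv\<^bsub>additive_group L\<^esub> x"

lemma lneg_closed: "x \<in> lcarrier L \<Longrightarrow> lneg x \<in> lcarrier L"
  by (simp add: lneg_def A.inv_closed)

lemma lneg_add: "x \<in> lcarrier L \<Longrightarrow> ladd L (lneg x) x = lzero L"
  by (simp add: lneg_def A.l_inv)

lemma lneg_eqI: "x \<in> lcarrier L \<Longrightarrow> y \<in> lcarrier L \<Longrightarrow> ladd L x y = lzero L \<Longrightarrow> x = lneg y"
  by (simp add: lneg_def A.inv_equality)

lemmas A_simps = A.m_closed lbr_closed lbr_add_left lbr_add_right A.m_ac A.one_closed A.l_one

lemma lbr_zero_left: "x \<in> lcarrier L \<Longrightarrow> lbr L (lzero L) x = lzero L"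
  using lbr_add_left [of "lzero L" "lzero L" x] by (simp add: A_simps)

lemma lbr_zero_right: "x \<in> lcarrier L \<Longrightarrow> lbr L x (lzero L) = lzero L"
  using lbr_add_right [of "lzero L" "lzero L" x] by (simp add: A_simps)

definition jac :: "'a \<Rightarrow> 'a \<Rightarrow> 'a \<Rightarrow> 'a" where
  "jac x y z = ladd L (ladd L (lbr L x (lbr L y z)) (lbr L y (lbr L z x))) (lbr L z (lbr L x y))"

lemma jac_rotate:
  "x \<in> lcarrier L \<Longrightarrow> y \<in> lcarrier L \<Longrightarrow> z \<in> lcarrier L \<Longrightarrow> jac y z x = jac x y z"
  by (simp add: jac_def A_simps)

lemma jac_add:
  "x \<in> lcarrier L \<Longrightarrow> x' \<in> lcarrier L \<Longrightarrow> y \<in> lcarrier L \<Longrightarrow> z \<in> lcarrier L \<Longrightarrow>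
   jac (ladd L x x') y z = ladd L (jac x y z) (jac x' y z)"
  by (simp add: jac_def A_simps)

lemma jac_zero: "y \<in> lcarrier L \<Longrightarrow> z \<in> lcarrier L \<Longrightarrow> jac (lzero L) y z = lzero L"
  by (simp add: jac_def A_simps lbr_zero_left lbr_zero_right)

text \<open>\<open>jac\<close> is additive in each argument, rotation giving access to all three, so
  additive generators suffice for Jacobi. The square [x, x] is only quadratic; its polarization is
  the symmetric form \<open>S\<close>, which is why antisymmetry on generators appears as a separate
  hypothesis.\<close>

lemma lie_ringI:
  assumes H: "H \<subseteq> lcarrier L"
    and induct: "\<And>P f. f \<in> lcarrier L \<Longrightarrow> P (lzero L) \<Longrightarrow> (\<And>h. h \<in> H \<Longrightarrow> P h) \<Longrightarrow>
      (\<And>f g. f \<in> lcarrier L \<Longrightarrow> g \<in> lcarrier L \<Longrightarrow> P f \<Longrightarrow> P g \<Longrightarrow> P (ladd L f g)) \<Longrightarrow> P f"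
    and self: "\<And>x. x \<in> H \<Longrightarrow> lbr L x x = lzero L"
    and anti: "\<And>x y. x \<in> H \<Longrightarrow> y \<in> H \<Longrightarrow> ladd L (lbr L x y) (lbr L y x) = lzero L"
    and jacobi: "\<And>x y z. x \<in> H \<Longrightarrow> y \<in> H \<Longrightarrow> z \<in> H \<Longrightarrow> jac x y z = lzero L"
  shows "lie_ring L"
proof -
  have H': "h \<in> lcarrier L" if "h \<in> H" for h using H that by blast
  define S where "S x y = ladd L (lbr L x y) (lbr L y x)" for x y
  have S_add: "S (ladd L f g) y = ladd L (S f y) (S g y)"
    if "f \<in> lcarrier L" "g \<in> lcarrier L" "y \<in> lcarrier L" for f g y
    using that by (simp add: S_def A_simps)
  have S_comm: "S x y = S y x" if "x \<in> lcarrier L" "y \<in> lcarrier L" for x y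
    using that by (simp add: S_def A_simps)
  have S_zero: "S (lzero L) y = lzero L" if "y \<in> lcarrier L" for y
    using that by (simp add: S_def lbr_zero_left lbr_zero_right A_simps)
  have S1: "S x y = lzero L" if "x \<in> lcarrier L" "y \<in> H" for x y
    using that(1)
  proof (rule induct)
    show "S h y = lzero L" if "h \<in> H" for h
      unfolding S_def using anti that \<open>y \<in> H\<close> by blast
  qed (simp_all add: S_zero S_add H' that A_simps)
  have S: "S x y = lzero L" if "x \<in> lcarrier L" "y \<in> lcarrier L" for x y
    using that(2)
  proof (rule induct [where P = "\<lambda>y. S x y = lzero L"])
    show "S x (lzero L) = lzero L" using S_zero S_comm that by (simp add: A_simps)
    show "S x (ladd L f g) = lzero L"
      if "f \<in> lcarrier L" "g \<in> lcarrier L" "S x f = lzero L" "S x g = lzero L" for f g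
      using that S_add [of f g x] S_comm [of x] \<open>x \<in> lcarrier L\<close> by (simp add: A_simps)
  qed (simp add: S1 that)
  have sq: "lbr L x x = lzero L" if "x \<in> lcarrier L" for x
    using that
  proof (rule induct)
    fix f g assume fg: "f \<in> lcarrier L" "g \<in> lcarrier L" "lbr L f f = lzero L" "lbr L g g = lzero L"
    have "lbr L (ladd L f g) (ladd L f g) = ladd L (ladd L (lbr L f f) (lbr L g g)) (S f g)"
      using fg(1,2) by (simp add: S_def A_simps)
    then show "lbr L (ladd L f g) (ladd L f g) = lzero L"
      using fg S by (simp add: A_simps)
  qed (simp_all add: self lbr_zero_left A_simps)
  have J1: "jac x y z = lzero L" if "x \<in> lcarrier L" "y \<in> H" "z \<in> H" for x y z
    using that(1) by (rule induct) (simp_all add: jac_zero jac_add jacobi H' that A_simps)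
  have J2: "jac x y z = lzero L" if "x \<in> lcarrier L" "y \<in> lcarrier L" "z \<in> H" for x y z
  proof -
    have "jac y z x = lzero L"
      using that(2)
    proof (rule induct)
      show "jac h z x = lzero L" if "h \<in> H" for h
        using J1 [of x h z] jac_rotate [of x h z] that \<open>x \<in> _\<close> \<open>z \<in> H\<close> H' by simp
    qed (simp_all add: jac_zero jac_add H' that A_simps)
    then show ?thesis using jac_rotate [of x y z] that H' by simp
  qed
  have J: "jac x y z = lzero L" if "x \<in> lcarrier L" "y \<in> lcarrier L" "z \<in> lcarrier L" for x y z
  proof -
    have "jac z x y = lzero L"
      using that(3)
    proof (rule induct)
      show "jac h x y = lzero L" if "h \<in> H" for h
        using J2 [of x y h] jac_rotate [of h x y] that \<open>x \<in> _\<close> \<open>y \<in> _\<close> H' by simp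
    qed (simp_all add: jac_zero jac_add that A_simps)
    then show ?thesis using jac_rotate [of z x y] that by simp
  qed
  show ?thesis
    unfolding lie_ring_def
    using additive lbr_closed lbr_add_left lbr_add_right sq J by (simp add: jac_def)
qed

end

lemma lie_ring_bilinear: "lie_ring L \<Longrightarrow> bilinear_ring L"
  by (simp add: lie_ring_def bilinear_ring_def)

section \<open>The associated graded Lie ring of a group\<close>

context group
begin

text \<open>Sequences of representatives replace sequences of cosets in computations. Lying
  eventually one step deeper corresponds to finite support.\<close>

definition fam :: "(nat \<Rightarrow> 'a) \<Rightarrow> bool" where
  "fam X \<longleftrightarrow> (\<forall>n>0. X n \<in> lcs G n) \<and> (\<exists>N. \<forall>n>N. X n \<in> lcs G (Suc n))"

definition mk :: "(nat \<Rightarrow> 'a) \<Rightarrow> nat \<Rightarrow> 'a set" where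
  "mk X n = (if n = 0 then {} else cl n (X n))"

definition msum :: "nat \<Rightarrow> (nat \<Rightarrow> 'a) \<Rightarrow> 'a" where
  "msum n F = foldr (\<lambda>i acc. F i \<otimes> acc) [1..<n] \<one>"

lemma fam_lcs: "fam X \<Longrightarrow> 0 < n \<Longrightarrow> X n \<in> lcs G n"
  by (simp add: fam_def)

lemma fam_carrier: "fam X \<Longrightarrow> 0 < n \<Longrightarrow> X n \<in> carrier G"
  using fam_lcs lcs_carrier by blast

lemma mk_cong: "(\<And>n. 0 < n \<Longrightarrow> cl n (X n) = cl n (Y n)) \<Longrightarrow> mk X = mk Y"
  by (simp add: mk_def fun_eq_iff)

lemma coset_rep_lcs_quot:
  assumes "C \<in> lcs_quot G n"
  shows "coset_rep C \<in> lcs G n" "cl n (coset_rep C) = C"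
proof -
  obtain x where x: "C = lcs G (Suc n) #> x" "x \<in> lcs G n"
    using assms by (auto simp: lcs_quot_def)
  then have "x \<in> C" using rcos_self [OF _ lcs_subgroup] by simp
  then have rep: "coset_rep C \<in> C" unfolding coset_rep_def by (rule someI)
  then obtain h where "h \<in> lcs G (Suc n)" "coset_rep C = h \<otimes> x"
    using x(1) by (auto simp: r_coset_def)
  then show "coset_rep C \<in> lcs G n" using x(2) lcs_Suc_subset [of n] by (auto simp: subset_iff)
  show "cl n (coset_rep C) = C"
    using repr_independence [OF _ _ lcs_subgroup] rep x by (simp add: cl_def)
qed

lemma fam_coset_rep:
  assumes "f \<in> lcarrier (assoc_graded G)"
  shows "fam (\<lambda>n. coset_rep (f n))" "mk (\<lambda>n. coset_rep (f n)) = f"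
proof -
  have f: "f 0 = {}" "\<And>n. 0 < n \<Longrightarrow> f n \<in> lcs_quot G n" "finite {n. 1 \<le> n \<and> f n \<noteq> lcs G (Suc n)}"
    using assms by (auto simp: assoc_graded_def)
  from f(3) obtain N where N: "\<forall>n\<in>{n. 1 \<le> n \<and> f n \<noteq> lcs G (Suc n)}. n \<le> N"
    using finite_nat_set_iff_bounded_le by blast
  have "coset_rep (f n) \<in> lcs G (Suc n)" if "n > N" for n
  proof -
    have "f n = lcs G (Suc n)" using N that by (metis (mono_tags, lifting) Suc_leI less_nat_zero_code mem_Collect_eq not_less One_nat_def gr_zeroI)
    then have one: "f n = cl n \<one>" by (simp add: cl_one)
    have q: "f n \<in> lcs_quot G n" using f(2) that by simp
    have "cl n (coset_rep (f n)) = cl n \<one>"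
      by (rule HOL.trans [OF coset_rep_lcs_quot(2) [OF q] one])
    then show ?thesis
      using cl_eq_iff [of "coset_rep (f n)" \<one> n] coset_rep_lcs_quot(1) [OF q] by simp
  qed
  then show "fam (\<lambda>n. coset_rep (f n))"
    using coset_rep_lcs_quot f(2) by (auto simp: fam_def)
  show "mk (\<lambda>n. coset_rep (f n)) = f"
    using coset_rep_lcs_quot(2) f by (simp add: mk_def fun_eq_iff)
qed

lemma mk_closed:
  assumes "fam X"
  shows "mk X \<in> lcarrier (assoc_graded G)"
proof -
  obtain N where N: "\<forall>n>N. X n \<in> lcs G (Suc n)" using assms by (auto simp: fam_def)
  have "{n. 1 \<le> n \<and> mk X n \<noteq> lcs G (Suc n)} \<subseteq> {..N}"
  proof
    fix n assume n: "n \<in> {n. 1 \<le> n \<and> mk X n \<noteq> lcs G (Suc n)}"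
    have "mk X n = lcs G (Suc n)" if "N < n"
      using cl_eq_one [of "X n" n] N that n by (simp add: mk_def cl_one)
    with n show "n \<in> {..N}" by (auto simp: not_le [symmetric])
  qed
  then have "finite {n. 1 \<le> n \<and> mk X n \<noteq> lcs G (Suc n)}" using finite_subset by blast
  moreover have "mk X n \<in> lcs_quot G n" if "n \<ge> 1" for n
    using that fam_lcs [OF assms, of n] by (auto simp: mk_def lcs_quot_def cl_def)
  ultimately show ?thesis by (simp add: assoc_graded_def mk_def)
qed

lemma mk_cases:
  assumes "f \<in> lcarrier (assoc_graded G)"
  obtains X where "fam X" "f = mk X"
  using fam_coset_rep [OF assms] by metis

lemma fam_mult: "fam X \<Longrightarrow> fam Y \<Longrightarrow> fam (\<lambda>n. X n \<otimes> Y n)"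
proof -
  assume "fam X" "fam Y"
  then obtain N M where NM: "\<And>n. n > N \<Longrightarrow> X n \<in> lcs G (Suc n)" "\<And>n. n > M \<Longrightarrow> Y n \<in> lcs G (Suc n)"
    by (auto simp: fam_def)
  show ?thesis
    unfolding fam_def
  proof (intro conjI exI allI impI)
    show "X n \<otimes> Y n \<in> lcs G n" if "n > 0" for n
      using \<open>fam X\<close> \<open>fam Y\<close> that by (simp add: fam_lcs)
    show "X n \<otimes> Y n \<in> lcs G (Suc n)" if "n > max N M" for n
      using that by (simp add: NM)
  qed
qed

lemma fam_inv: "fam X \<Longrightarrow> fam (\<lambda>n. inv (X n))"
  unfolding fam_def by (meson lcs_inv)

lemma fam_one: "fam (\<lambda>n. \<one>)"
  by (simp add: fam_def)

lemma ladd_mk: "fam X \<Longrightarrow> fam Y \<Longrightarrow> ladd (assoc_graded G) (mk X) (mk Y) = mk (\<lambda>n. X n \<otimes> Y n)"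
  by (simp add: assoc_graded_def mk_def fun_eq_iff fam_carrier cl_mult)

lemma lzero_mk: "lzero (assoc_graded G) = mk (\<lambda>n. \<one>)"
  by (auto simp: assoc_graded_def mk_def fun_eq_iff cl_one)

lemma msum_lcs: "(\<And>i. 0 < i \<Longrightarrow> i < n \<Longrightarrow> F i \<in> lcs G k) \<Longrightarrow> msum n F \<in> lcs G k"
proof -
  have "(\<forall>i\<in>set xs. F i \<in> lcs G k) \<Longrightarrow> foldr (\<lambda>i acc. F i \<otimes> acc) xs \<one> \<in> lcs G k" for xs
    by (induction xs) auto
  then show "(\<And>i. 0 < i \<Longrightarrow> i < n \<Longrightarrow> F i \<in> lcs G k) \<Longrightarrow> msum n F \<in> lcs G k"
    by (simp add: msum_def)
qed

lemma cl_msum_cong: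
  assumes "\<And>i. 0 < i \<Longrightarrow> i < n \<Longrightarrow> F i \<in> carrier G \<and> F' i \<in> carrier G \<and> cl k (F i) = cl k (F' i)"
  shows "cl k (msum n F) = cl k (msum n F')"
proof -
  have "(\<forall>i\<in>set xs. F i \<in> carrier G \<and> F' i \<in> carrier G \<and> cl k (F i) = cl k (F' i)) \<Longrightarrow>
      foldr (\<lambda>i acc. F i \<otimes> acc) xs \<one> \<in> carrier G \<and> foldr (\<lambda>i acc. F' i \<otimes> acc) xs \<one> \<in> carrier G \<and>
      cl k (foldr (\<lambda>i acc. F i \<otimes> acc) xs \<one>) = cl k (foldr (\<lambda>i acc. F' i \<otimes> acc) xs \<one>)" for xs
  proof (induction xs)
    case (Cons a xs)
    then show ?case
      using cl_mult_cong [of k "F a" "F' a" "foldr (\<lambda>i acc. F i \<otimes> acc) xs \<one>"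
          "foldr (\<lambda>i acc. F' i \<otimes> acc) xs \<one>"] by simp
  qed simp
  then show ?thesis using assms by (simp add: msum_def)
qed

lemma cl_msum_mult:
  assumes "\<And>i. 0 < i \<Longrightarrow> i < n \<Longrightarrow> F i \<in> lcs G k \<and> F' i \<in> lcs G k" and "0 < k"
  shows "cl k (msum n (\<lambda>i. F i \<otimes> F' i)) = cl k (msum n F \<otimes> msum n F')"
proof -
  define p where "p F xs = foldr (\<lambda>i acc. F i \<otimes> acc) xs \<one>" for F and xs :: "nat list"
  have "(\<forall>i\<in>set xs. F i \<in> lcs G k \<and> F' i \<in> lcs G k) \<Longrightarrow>
      p F xs \<in> lcs G k \<and> p F' xs \<in> lcs G k \<and> p (\<lambda>i. F i \<otimes> F' i) xs \<in> lcs G k \<and>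
      cl k (p (\<lambda>i. F i \<otimes> F' i) xs) = cl k (p F xs \<otimes> p F' xs)" for xs
  proof (induction xs)
    case (Cons i xs)
    define u v where "u = F i" and "v = F' i"
    define a b where "a = p F xs" and "b = p F' xs"
    have mem: "u \<in> lcs G k" "v \<in> lcs G k" "a \<in> lcs G k" "b \<in> lcs G k" "p (\<lambda>i. F i \<otimes> F' i) xs \<in> lcs G k"
      and IH: "cl k (p (\<lambda>i. F i \<otimes> F' i) xs) = cl k (a \<otimes> b)"
      using Cons by (auto simp: u_def v_def a_def b_def)
    have "cl k (p (\<lambda>i. F i \<otimes> F' i) (i # xs)) = cl k ((u \<otimes> v) \<otimes> p (\<lambda>i. F i \<otimes> F' i) xs)"
      by (simp add: p_def u_def v_def)
    also have "\<dots> = cl k ((u \<otimes> v) \<otimes> (a \<otimes> b))"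
      using mem IH by (intro cl_mult_cong) auto
    also have "\<dots> = cl k (u \<otimes> ((v \<otimes> a) \<otimes> b))"
      using mem by (simp add: m_assoc)
    also have "\<dots> = cl k (u \<otimes> ((a \<otimes> v) \<otimes> b))"
      using mem \<open>0 < k\<close> by (intro cl_mult_cong cl_commute HOL.refl) auto
    also have "\<dots> = cl k ((u \<otimes> a) \<otimes> (v \<otimes> b))"
      using mem by (simp add: m_assoc)
    finally show ?case using mem by (simp add: p_def u_def v_def a_def b_def)
  qed (simp add: p_def)
  then show ?thesis using assms by (simp add: msum_def p_def)
qed

text \<open>This removes the arbitrary choice in \<open>coset_rep\<close>: any family of
  representatives computes the bracket.\<close>

lemma lbr_mk:
  assumes X: "fam X" and Y: "fam Y"
  shows "lbr (assoc_graded G) (mk X) (mk Y) = mk (\<lambda>n. msum n (\<lambda>i. gcomm G (X i) (Y (n - i))))"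
proof -
  have X': "coset_rep (mk X i) \<in> lcs G i" "cl i (coset_rep (mk X i)) = cl i (X i)"
    and Y': "coset_rep (mk Y i) \<in> lcs G i" "cl i (coset_rep (mk Y i)) = cl i (Y i)" if "0 < i" for i
    using coset_rep_lcs_quot [of "mk X i" i] coset_rep_lcs_quot [of "mk Y i" i]
      mk_closed X Y that by (auto simp: assoc_graded_def mk_def Suc_le_eq)
  have "cl n (msum n (\<lambda>i. gcomm G (coset_rep (mk X i)) (coset_rep (mk Y (n - i))))) =
      cl n (msum n (\<lambda>i. gcomm G (X i) (Y (n - i))))" for n
  proof (rule cl_msum_cong, intro conjI)
    fix i assume i: "0 < i" "i < n"
    show "cl n (gcomm G (coset_rep (mk X i)) (coset_rep (mk Y (n - i)))) =
        cl n (gcomm G (X i) (Y (n - i)))"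
      using cl_gcomm_cong [of i "coset_rep (mk X i)" "X i" "n - i" "coset_rep (mk Y (n - i))" "Y (n - i)"]
        X' Y' fam_lcs [OF X] fam_lcs [OF Y] i by simp
    show "gcomm G (coset_rep (mk X i)) (coset_rep (mk Y (n - i))) \<in> carrier G"
      using X'(1) [of i] Y'(1) [of "n - i"] i by simp
    show "gcomm G (X i) (Y (n - i)) \<in> carrier G"
      using fam_lcs [OF X, of i] fam_lcs [OF Y, of "n - i"] i by simp
  qed
  then show ?thesis
    by (auto simp: assoc_graded_def mk_def msum_def cl_def fun_eq_iff)
qed

lemma gcomm_fam:
  assumes "fam X" "fam Y" "0 < i" "i < n"
  shows "gcomm G (X i) (Y (n - i)) \<in> lcs G n"
  using gcomm_lcs [of "X i" i "Y (n - i)" "n - i"] assms by (simp add: fam_lcs)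

lemma fam_bracket:
  assumes X: "fam X" and Y: "fam Y"
  shows "fam (\<lambda>n. msum n (\<lambda>i. gcomm G (X i) (Y (n - i))))"
proof -
  obtain N M where N: "\<And>n. n > N \<Longrightarrow> X n \<in> lcs G (Suc n)" and M: "\<And>n. n > M \<Longrightarrow> Y n \<in> lcs G (Suc n)"
    using assms by (auto simp: fam_def)
  \<comment> \<open>For n > N + M either i > N or n - i > M, so one argument of each commutator lies
    a step deeper than its index.\<close>
  have "msum n (\<lambda>i. gcomm G (X i) (Y (n - i))) \<in> lcs G (Suc n)" if n: "n > N + M" for n
  proof (rule msum_lcs)
    fix i assume i: "0 < i" "i < n"
    show "gcomm G (X i) (Y (n - i)) \<in> lcs G (Suc n)"
    proof (cases "i > N")
      case True
      then show ?thesis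
        using gcomm_lcs [of "X i" "Suc i" "Y (n - i)" "n - i"] N [of i] fam_lcs [OF Y, of "n - i"] i by simp
    next
      case False
      then show ?thesis
        using gcomm_lcs [of "X i" i "Y (n - i)" "Suc (n - i)"] M [of "n - i"] fam_lcs [OF X, of i] i n
        by simp
    qed
  qed
  then show ?thesis
    unfolding fam_def by (auto intro!: msum_lcs gcomm_fam X Y)
qed

lemma bilinear_assoc_graded: "bilinear_ring (assoc_graded G)"
proof (rule bilinear_ring.intro)
  show "comm_group (additive_group (assoc_graded G))"
  proof (rule comm_groupI)
    fix f assume "f \<in> carrier (additive_group (assoc_graded G))"
    then obtain X where X: "fam X" "f = mk X"
      by (auto simp: additive_group_def elim: mk_cases)
    have "mk (\<lambda>n. inv (X n) \<otimes> X n) = mk (\<lambda>n. \<one>)"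
      using X(1) by (intro mk_cong) (simp add: fam_carrier)
    then show "\<exists>g\<in>carrier (additive_group (assoc_graded G)).
        g \<otimes>\<^bsub>additive_group (assoc_graded G)\<^esub> f = \<one>\<^bsub>additive_group (assoc_graded G)\<^esub>"
      using X by (auto simp: additive_group_def ladd_mk fam_inv lzero_mk mk_closed intro!: bexI [of _ "mk (\<lambda>n. inv (X n))"])
  next
    show "f \<otimes>\<^bsub>additive_group (assoc_graded G)\<^esub> g = g \<otimes>\<^bsub>additive_group (assoc_graded G)\<^esub> f"
      if "f \<in> carrier (additive_group (assoc_graded G))" and "g \<in> carrier (additive_group (assoc_graded G))" for f g
    proof -
      obtain X Y where fam: "fam X" "fam Y" and mk: "f = mk X" "g = mk Y"
        using \<open>f \<in> _\<close> \<open>g \<in> _\<close> by (auto simp: additive_group_def elim!: mk_cases)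
      have "mk (\<lambda>n. X n \<otimes> Y n) = mk (\<lambda>n. Y n \<otimes> X n)"
        using fam by (intro mk_cong cl_commute) (auto simp: fam_carrier fam_lcs)
      then show ?thesis using fam by (simp add: mk additive_group_def ladd_mk)
    qed
  next
    fix f g h
    assume "f \<in> carrier (additive_group (assoc_graded G))" "g \<in> carrier (additive_group (assoc_graded G))"
      "h \<in> carrier (additive_group (assoc_graded G))"
    then obtain X Y Z where fam: "fam X" "fam Y" "fam Z" and mk: "f = mk X" "g = mk Y" "h = mk Z"
      by (auto simp: additive_group_def elim!: mk_cases)
    have "mk (\<lambda>n. X n \<otimes> Y n \<otimes> Z n) = mk (\<lambda>n. X n \<otimes> (Y n \<otimes> Z n))"
      using fam by (intro mk_cong) (simp add: fam_carrier m_assoc)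
    then show "f \<otimes>\<^bsub>additive_group (assoc_graded G)\<^esub> g \<otimes>\<^bsub>additive_group (assoc_graded G)\<^esub> h
        = f \<otimes>\<^bsub>additive_group (assoc_graded G)\<^esub> (g \<otimes>\<^bsub>additive_group (assoc_graded G)\<^esub> h)"
      using fam by (simp add: mk additive_group_def ladd_mk fam_mult)
  next
    fix f assume "f \<in> carrier (additive_group (assoc_graded G))"
    then obtain X where X: "fam X" "f = mk X"
      by (auto simp: additive_group_def elim: mk_cases)
    have "mk (\<lambda>n. \<one> \<otimes> X n) = mk X"
      using X by (intro mk_cong) (simp add: fam_carrier)
    then show "\<one>\<^bsub>additive_group (assoc_graded G)\<^esub> \<otimes>\<^bsub>additive_group (assoc_graded G)\<^esub> f = f"
      using X by (simp add: additive_group_def ladd_mk lzero_mk fam_one)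
  qed (auto simp: additive_group_def ladd_mk lzero_mk intro!: mk_closed fam_mult fam_one elim!: mk_cases)
next
  fix f g h
  assume "f \<in> lcarrier (assoc_graded G)" "g \<in> lcarrier (assoc_graded G)" "h \<in> lcarrier (assoc_graded G)"
  then obtain X Y Z where fam: "fam X" "fam Y" "fam Z" and mk: "f = mk X" "g = mk Y" "h = mk Z"
    by (metis mk_cases)
  have "cl n (msum n (\<lambda>i. gcomm G (X i \<otimes> Y i) (Z (n - i)))) =
      cl n (msum n (\<lambda>i. gcomm G (X i) (Z (n - i)) \<otimes> gcomm G (Y i) (Z (n - i))))" for n
  proof (rule cl_msum_cong, intro conjI)
    fix i assume i: "0 < i" "i < n"
    show "cl n (gcomm G (X i \<otimes> Y i) (Z (n - i))) =
        cl n (gcomm G (X i) (Z (n - i)) \<otimes> gcomm G (Y i) (Z (n - i)))"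
      using cl_gcomm_mult_left [of "X i" i "Y i" "Z (n - i)" "n - i"] fam i by (simp add: fam_lcs)
  qed (use fam in \<open>auto simp: fam_carrier\<close>)
  then have left: "cl n (msum n (\<lambda>i. gcomm G (X i \<otimes> Y i) (Z (n - i)))) =
      cl n (msum n (\<lambda>i. gcomm G (X i) (Z (n - i))) \<otimes> msum n (\<lambda>i. gcomm G (Y i) (Z (n - i))))"
    if "0 < n" for n
    using that fam cl_msum_mult [of n "\<lambda>i. gcomm G (X i) (Z (n - i))" n "\<lambda>i. gcomm G (Y i) (Z (n - i))"]
    by (simp add: gcomm_fam)
  show "lbr (assoc_graded G) (ladd (assoc_graded G) f g) h =
      ladd (assoc_graded G) (lbr (assoc_graded G) f h) (lbr (assoc_graded G) g h)"
    unfolding mk using fam by (simp add: ladd_mk lbr_mk fam_mult fam_bracket) (rule mk_cong, rule left)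
  have "cl n (msum n (\<lambda>i. gcomm G (Z i) (X (n - i) \<otimes> Y (n - i)))) =
      cl n (msum n (\<lambda>i. gcomm G (Z i) (X (n - i)) \<otimes> gcomm G (Z i) (Y (n - i))))" for n
  proof (rule cl_msum_cong, intro conjI)
    fix i assume i: "0 < i" "i < n"
    show "cl n (gcomm G (Z i) (X (n - i) \<otimes> Y (n - i))) =
        cl n (gcomm G (Z i) (X (n - i)) \<otimes> gcomm G (Z i) (Y (n - i)))"
      using cl_gcomm_mult_right [of "Z i" i "X (n - i)" "n - i" "Y (n - i)"] fam i by (simp add: fam_lcs)
  qed (use fam in \<open>auto simp: fam_carrier\<close>)
  then have right: "cl n (msum n (\<lambda>i. gcomm G (Z i) (X (n - i) \<otimes> Y (n - i)))) =
      cl n (msum n (\<lambda>i. gcomm G (Z i) (X (n - i))) \<otimes> msum n (\<lambda>i. gcomm G (Z i) (Y (n - i))))"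
    if "0 < n" for n
    using that fam cl_msum_mult [of n "\<lambda>i. gcomm G (Z i) (X (n - i))" n "\<lambda>i. gcomm G (Z i) (Y (n - i))"]
    by (simp add: gcomm_fam)
  show "lbr (assoc_graded G) h (ladd (assoc_graded G) f g) =
      ladd (assoc_graded G) (lbr (assoc_graded G) h f) (lbr (assoc_graded G) h g)"
    unfolding mk using fam by (simp add: ladd_mk lbr_mk fam_mult fam_bracket) (rule mk_cong, rule right)
qed (auto simp: lbr_mk intro!: mk_closed fam_bracket elim!: mk_cases)

end


section \<open>Homogeneous elements and generation in degree one\<close>

context group
begin

definition hel :: "nat \<Rightarrow> 'a \<Rightarrow> nat \<Rightarrow> 'a set" where
  "hel n x = mk (\<lambda>k. if k = n then x else \<one>)"

lemma fam_hel: "x \<in> lcs G n \<Longrightarrow> fam (\<lambda>k. if k = n then x else \<one>)"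
  unfolding fam_def by (intro conjI exI [of _ n]) auto

lemma hel_closed: "x \<in> lcs G n \<Longrightarrow> hel n x \<in> lcarrier (assoc_graded G)"
  unfolding hel_def by (intro mk_closed fam_hel)

lemma hel_cong: "cl n x = cl n y \<Longrightarrow> hel n x = hel n y"
  unfolding hel_def by (rule mk_cong) simp

lemma hel_one: "hel n \<one> = lzero (assoc_graded G)"
  by (simp add: hel_def lzero_mk)

lemma hel_mult:
  assumes "x \<in> lcs G n" "y \<in> lcs G n"
  shows "ladd (assoc_graded G) (hel n x) (hel n y) = hel n (x \<otimes> y)"
proof -
  have "(\<lambda>k. (if k = n then x else \<one>) \<otimes> (if k = n then y else \<one>)) = (\<lambda>k. if k = n then x \<otimes> y else \<one>)"
    by auto
  then show ?thesis using assms by (simp add: hel_def ladd_mk fam_hel)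
qed

lemma msum_single:
  assumes "\<And>i. i \<noteq> m \<Longrightarrow> F i = \<one>" "F m \<in> carrier G"
  shows "msum n F = (if 0 < m \<and> m < n then F m else \<one>)"
proof -
  have "distinct xs \<Longrightarrow> foldr (\<lambda>i acc. F i \<otimes> acc) xs \<one> = (if m \<in> set xs then F m else \<one>)" for xs
  proof (induction xs)
    case (Cons a xs)
    then show ?case using assms by (cases "a = m") auto
  qed simp
  from this [of "[1..<n]"] show ?thesis by (simp add: msum_def Suc_le_eq)
qed

lemma hel_bracket:
  assumes x: "x \<in> lcs G m" and y: "y \<in> lcs G n" and pos: "0 < m" "0 < n"
  shows "lbr (assoc_graded G) (hel m x) (hel n y) = hel (m + n) (gcomm G x y)"
proof -
  have "msum k (\<lambda>i. gcomm G (if i = m then x else \<one>) (if k - i = n then y else \<one>)) =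
      (if k = m + n then gcomm G x y else \<one>)" for k
    using x y pos by (subst msum_single [of m]) auto
  then show ?thesis
    using x y by (simp add: hel_def lbr_mk fam_hel)
qed

text \<open>Finite support allows the component of highest degree to be split off
  repeatedly.\<close>

lemma assoc_graded_induct [consumes 1, case_names zero hel add]:
  assumes f: "f \<in> lcarrier (assoc_graded G)"
    and zero: "P (lzero (assoc_graded G))"
    and hel: "\<And>n x. 0 < n \<Longrightarrow> x \<in> lcs G n \<Longrightarrow> P (hel n x)"
    and add: "\<And>f g. f \<in> lcarrier (assoc_graded G) \<Longrightarrow> g \<in> lcarrier (assoc_graded G) \<Longrightarrow>
      P f \<Longrightarrow> P g \<Longrightarrow> P (ladd (assoc_graded G) f g)"
  shows "P f"
proof -
  have *: "P (mk X)" if "fam X" "\<forall>n>N. X n = \<one>" for N X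
    using that
  proof (induction N arbitrary: X)
    case 0
    then have "mk X = lzero (assoc_graded G)" by (auto simp: lzero_mk intro!: mk_cong)
    then show ?case using zero by simp
  next
    case (Suc N)
    define Y where "Y = X(Suc N := \<one>)"
    have Y: "fam Y"
      using Suc.prems unfolding fam_def Y_def by (intro conjI exI [of _ "Suc N"]) auto
    have x: "X (Suc N) \<in> lcs G (Suc N)" using fam_lcs [OF Suc.prems(1)] by simp
    have "\<forall>n>N. Y n = \<one>" using Suc.prems(2) by (simp add: Y_def)
    then have "P (mk Y)" using Suc.IH Y by blast
    then have "P (ladd (assoc_graded G) (mk Y) (hel (Suc N) (X (Suc N))))"
      using add hel [OF _ x] hel_closed [OF x] mk_closed [OF Y] by simp
    moreover have "ladd (assoc_graded G) (mk Y) (hel (Suc N) (X (Suc N))) = mk X"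
      unfolding hel_def ladd_mk [OF Y fam_hel [OF x]]
      using fam_carrier [OF Suc.prems(1)] by (intro mk_cong) (simp add: Y_def)
    ultimately show ?case by simp
  qed
  obtain X where X: "fam X" "f = mk X" using f by (rule mk_cases)
  obtain N where N: "\<And>n. n > N \<Longrightarrow> X n \<in> lcs G (Suc n)" using X by (auto simp: fam_def)
  \<comment> \<open>Beyond N the representatives lie in the next term, so replacing them by the
    identity does not change the cosets.\<close>
  define Y where "Y n = (if n > N then \<one> else X n)" for n
  have "fam Y" using X unfolding fam_def Y_def by (intro conjI exI [of _ N]) auto
  moreover have "mk Y = mk X"
    by (rule mk_cong) (simp add: Y_def cl_eq_one [OF N])
  ultimately show ?thesis using * [of Y N] X by (simp add: Y_def)
qed

interpretation LG: bilinear_ring "assoc_graded G"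
  by (rule bilinear_assoc_graded)

theorem lie_ring_assoc_graded: "lie_ring (assoc_graded G)"
proof (rule LG.lie_ringI)
  let ?H = "{hel n x | n x. 0 < n \<and> x \<in> lcs G n}"
  show "?H \<subseteq> lcarrier (assoc_graded G)" using hel_closed by auto
  show "P f" if "f \<in> lcarrier (assoc_graded G)" "P (lzero (assoc_graded G))" "\<And>h. h \<in> ?H \<Longrightarrow> P h"
    "\<And>f g. f \<in> lcarrier (assoc_graded G) \<Longrightarrow> g \<in> lcarrier (assoc_graded G) \<Longrightarrow> P f \<Longrightarrow> P g \<Longrightarrow>
      P (ladd (assoc_graded G) f g)" for P f
    using that(1)
  proof (induction rule: assoc_graded_induct)
    case (hel n x)
    then show ?case by (intro that(3)) blast
  qed (use that in auto)
next
  fix u assume "u \<in> {hel n x | n x. 0 < n \<and> x \<in> lcs G n}"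
  then obtain n x where "u = hel n x" "0 < n" "x \<in> lcs G n" by blast
  then show "lbr (assoc_graded G) u u = lzero (assoc_graded G)"
    by (simp add: hel_bracket gcomm_def m_assoc hel_one)
next
  fix u v assume "u \<in> {hel n x | n x. 0 < n \<and> x \<in> lcs G n}" "v \<in> {hel n x | n x. 0 < n \<and> x \<in> lcs G n}"
  then obtain m x n y where uv: "u = hel m x" "0 < m" "x \<in> lcs G m" "v = hel n y" "0 < n" "y \<in> lcs G n"
    by blast
  then have "lbr (assoc_graded G) v u = hel (m + n) (inv (gcomm G x y))"
    using gcomm_swap [of x y] by (simp add: hel_bracket add.commute)
  then show "ladd (assoc_graded G) (lbr (assoc_graded G) u v) (lbr (assoc_graded G) v u) = lzero (assoc_graded G)"
    using uv by (simp add: hel_bracket hel_mult gcomm_lcs hel_one)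
next
  fix u v w assume "u \<in> {hel n x | n x. 0 < n \<and> x \<in> lcs G n}"
    "v \<in> {hel n x | n x. 0 < n \<and> x \<in> lcs G n}" "w \<in> {hel n x | n x. 0 < n \<and> x \<in> lcs G n}"
  then obtain l x m y n z where uvw: "u = hel l x" "v = hel m y" "w = hel n z"
    and pos: "0 < l" "0 < m" "0 < n" and mem: "x \<in> lcs G l" "y \<in> lcs G m" "z \<in> lcs G n"
    by blast
  have c: "gcomm G y z \<in> lcs G (m + n)" "gcomm G z x \<in> lcs G (n + l)" "gcomm G x y \<in> lcs G (l + m)"
    using pos mem by (auto intro: gcomm_lcs)
  have d: "gcomm G x (gcomm G y z) \<in> lcs G (l + m + n)" "gcomm G y (gcomm G z x) \<in> lcs G (l + m + n)"
    "gcomm G z (gcomm G x y) \<in> lcs G (l + m + n)"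
    using gcomm_lcs [OF mem(1) c(1)] gcomm_lcs [OF mem(2) c(2)] gcomm_lcs [OF mem(3) c(3)] pos
    by (simp_all add: ac_simps)
  have "LG.jac u v w = hel (l + m + n) (gcomm G x (gcomm G y z) \<otimes> gcomm G y (gcomm G z x) \<otimes> gcomm G z (gcomm G x y))"
    using hel_bracket [OF mem(1) c(1)] hel_bracket [OF mem(2) c(2)] hel_bracket [OF mem(3) c(3)] pos mem d
    by (simp add: LG.jac_def uvw hel_bracket hel_mult ac_simps)
  also have "\<dots> = hel (l + m + n) \<one>"
    using mem pos by (intro hel_cong cl_jacobi)
  finally show "LG.jac u v w = lzero (assoc_graded G)" by (simp add: hel_one)
qed

lemma hel_inv:
  assumes "x \<in> lcs G n"
  shows "hel n (inv x) = LG.lneg (hel n x)"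
  using assms by (intro LG.lneg_eqI) (simp_all add: hel_closed hel_mult hel_one)

lemma deg1_class_eq_hel: "deg1_class G x = hel 1 x"
  by (simp add: deg1_class_def hel_def mk_def fun_eq_iff cl_one cl_def [of "Suc 0" x] numeral_2_eq_2)

text \<open>A generator [x, y] of the next term of the series, with y in the whole group, has as its
  class the bracket of the class of x with a class of degree 1; and degree 1 is additively generated
  by the classes of S.\<close>

lemma assoc_graded_generated:
  assumes f: "f \<in> lcarrier (assoc_graded G)" and S: "S \<subseteq> carrier G" "generate G S = carrier G"
    and zero: "P (lzero (assoc_graded G))"
    and gen: "\<And>s. s \<in> S \<Longrightarrow> P (hel 1 s)"
    and neg: "\<And>f. f \<in> lcarrier (assoc_graded G) \<Longrightarrow> P f \<Longrightarrow> P (LG.lneg f)"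
    and add: "\<And>f g. f \<in> lcarrier (assoc_graded G) \<Longrightarrow> g \<in> lcarrier (assoc_graded G) \<Longrightarrow>
      P f \<Longrightarrow> P g \<Longrightarrow> P (ladd (assoc_graded G) f g)"
    and br: "\<And>f g. f \<in> lcarrier (assoc_graded G) \<Longrightarrow> g \<in> lcarrier (assoc_graded G) \<Longrightarrow>
      P f \<Longrightarrow> P g \<Longrightarrow> P (lbr (assoc_graded G) f g)"
  shows "P f"
proof -
  have generate: "P (hel n x)" if "x \<in> generate G H" "H \<subseteq> lcs G n" "\<And>h. h \<in> H \<Longrightarrow> P (hel n h)" for n x H
  proof -
    have "x \<in> lcs G n \<and> P (hel n x)"
      using that(1)
    proof (induction rule: generate.induct)
      case one
      then show ?case by (simp add: hel_one zero)
    next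
      case (incl h)
      then show ?case using that by blast
    next
      case (inv h)
      then show ?case using that neg hel_closed by (auto simp: hel_inv subset_iff)
    next
      case (eng h1 h2)
      then show ?case using add [of "hel n h1" "hel n h2"] by (simp add: hel_mult hel_closed)
    qed
    then show ?thesis ..
  qed
  have 1: "P (hel 1 x)" if "x \<in> carrier G" for x
    using generate [of x S 1] that S gen by simp
  have "P (hel n x)" if "0 < n" "x \<in> lcs G n" for n x
    using that
  proof (induction n arbitrary: x rule: nat_induct_non_zero)
    case 1
    then show ?case using \<open>\<And>x. x \<in> carrier G \<Longrightarrow> P (hel 1 x)\<close> by simp
  next
    case (Suc n)
    have "x \<in> generate G {gcomm G x y |x y. x \<in> lcs G n \<and> y \<in> carrier G}"
      using Suc by (simp add: lcs_Suc)
    then show ?case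
    proof (rule generate)
      show "{gcomm G x y |x y. x \<in> lcs G n \<and> y \<in> carrier G} \<subseteq> lcs G (Suc n)"
        using gcomm_lcs_Suc Suc.hyps by auto
      fix h assume "h \<in> {gcomm G x y |x y. x \<in> lcs G n \<and> y \<in> carrier G}"
      then obtain x y where h: "h = gcomm G x y" "x \<in> lcs G n" "y \<in> carrier G" by blast
      have "P (lbr (assoc_graded G) (hel n x) (hel 1 y))"
        using h Suc.IH 1 by (intro br hel_closed) auto
      then show "P (hel (Suc n) h)"
        using h Suc.hyps hel_bracket [of x n y 1] by simp
    qed
  qed
  with f show ?thesis
    by (induction rule: assoc_graded_induct) (auto simp: zero add)
qed

end


section \<open>Presented groups\<close>

lemma pres_rel_cong: "pres_rel Q u v \<Longrightarrow> pres_rel Q (a @ u @ b) (a @ v @ b)"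
proof (induction rule: pres_rel.induct)
  case (sym u w)
  show ?case by (rule pres_rel.sym) (rule sym.IH)
next
  case (trans u v w)
  show ?case by (rule pres_rel.trans) (rule trans.IH)+
next
  case (cancel u c x v)
  show ?case using pres_rel.cancel [of Q "a @ u" c x "v @ b"] by simp
next
  case (relator r u v)
  then show ?case using pres_rel.relator [of r Q "a @ u" "v @ b"] by simp
qed (simp add: pres_rel.refl)

lemma pres_rel_append:
  assumes "pres_rel Q u u'" "pres_rel Q v v'"
  shows "pres_rel Q (u @ v) (u' @ v')"
  using pres_rel_cong [OF assms(1), of "[]" v] pres_rel_cong [OF assms(2), of u' "[]"]
  by (auto intro: pres_rel.trans)

lemma pres_rel_inv_word: "pres_rel Q (inv_word w @ w) []"
proof (induction w)
  case Nil
  show ?case by (simp add: inv_word_def pres_rel.refl)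
next
  case (Cons p w)
  obtain c x where p: "p = (c, x)" by fastforce
  have "pres_rel Q (inv_word w @ [(\<not> c, x), (\<not> \<not> c, x)] @ w) (inv_word w @ w)"
    by (rule pres_rel.cancel)
  then show ?case
    using Cons.IH by (auto simp: inv_word_def p intro: pres_rel.trans)
qed

lemma set_inv_word: "set w \<subseteq> UNIV \<times> S \<Longrightarrow> set (inv_word w) \<subseteq> UNIV \<times> S"
  by (auto simp: inv_word_def)

lemma word_class_eq_iff:
  assumes "set v \<subseteq> UNIV \<times> S" "set w \<subseteq> UNIV \<times> S"
  shows "word_class S Q v = word_class S Q w \<longleftrightarrow> pres_rel Q v w"
proof
  assume "word_class S Q v = word_class S Q w"
  moreover have "w \<in> word_class S Q w" using assms by (simp add: word_class_def pres_rel.refl)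
  ultimately have "w \<in> word_class S Q v" by simp
  then show "pres_rel Q v w" by (simp add: word_class_def)
next
  assume "pres_rel Q v w"
  then show "word_class S Q v = word_class S Q w"
    unfolding word_class_def by (blast intro: pres_rel.trans pres_rel.sym)
qed

lemma presented_mult:
  assumes "set v \<subseteq> UNIV \<times> S" "set w \<subseteq> UNIV \<times> S"
  shows "word_class S Q v \<otimes>\<^bsub>presented_group S Q\<^esub> word_class S Q w = word_class S Q (v @ w)"
proof -
  have "pres_rel Q (v @ w) z" if "pres_rel Q v x" "pres_rel Q w y" "pres_rel Q (x @ y) z" for x y z
    using that pres_rel_append pres_rel.trans by metis
  then show ?thesis
    using assms unfolding presented_group_def word_class_def
    by (auto intro: pres_rel.refl)
qed

lemma presented_carrier:
  "P \<in> carrier (presented_group S Q) \<longleftrightarrow> (\<exists>v. set v \<subseteq> UNIV \<times> S \<and> P = word_class S Q v)"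
  by (auto simp: presented_group_def)

lemma presented_one: "\<one>\<^bsub>presented_group S Q\<^esub> = word_class S Q []"
  by (simp add: presented_group_def)

lemma group_presented: "group (presented_group S Q)"
proof (rule groupI)
  fix P assume "P \<in> carrier (presented_group S Q)"
  then obtain v where v: "set v \<subseteq> UNIV \<times> S" "P = word_class S Q v"
    by (auto simp: presented_carrier)
  have "word_class S Q (inv_word v) \<otimes>\<^bsub>presented_group S Q\<^esub> P = \<one>\<^bsub>presented_group S Q\<^esub>"
    using v set_inv_word [OF v(1)] pres_rel_inv_word [of Q v]
    by (simp add: presented_mult presented_one word_class_eq_iff)
  then show "\<exists>y\<in>carrier (presented_group S Q). y \<otimes>\<^bsub>presented_group S Q\<^esub> P = \<one>\<^bsub>presented_group S Q\<^esub>"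
    using set_inv_word [OF v(1)] by (intro bexI) (auto simp: presented_carrier)
next
  fix P P' assume "P \<in> carrier (presented_group S Q)" "P' \<in> carrier (presented_group S Q)"
  then obtain v w where "set v \<subseteq> UNIV \<times> S" "P = word_class S Q v" "set w \<subseteq> UNIV \<times> S" "P' = word_class S Q w"
    by (auto simp: presented_carrier)
  then show "P \<otimes>\<^bsub>presented_group S Q\<^esub> P' \<in> carrier (presented_group S Q)"
    by (auto simp: presented_carrier presented_mult intro!: exI [of _ "v @ w"])
next
  show "\<one>\<^bsub>presented_group S Q\<^esub> \<in> carrier (presented_group S Q)"
    by (auto simp: presented_carrier presented_one intro!: exI [of _ "[]"])
qed (auto simp: presented_carrier presented_mult presented_one)

lemma gen_elem_closed: "x \<in> S \<Longrightarrow> gen_elem S Q x \<in> carrier (presented_group S Q)"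
  by (auto simp: presented_carrier gen_elem_def intro!: exI [of _ "[(True, x)]"])

lemma presented_inv_gen:
  assumes "x \<in> S"
  shows "inv\<^bsub>presented_group S Q\<^esub> (gen_elem S Q x) = word_class S Q [(False, x)]"
proof -
  interpret group "presented_group S Q" by (rule group_presented)
  have "pres_rel Q [(False, x), (True, x)] []"
    using pres_rel.cancel [of Q "[]" False x "[]"] by simp
  then show ?thesis
    using assms by (intro inv_equality gen_elem_closed)
      (auto simp: gen_elem_def presented_mult presented_one word_class_eq_iff presented_carrier
        intro!: exI [of _ "[(False, x)]"])
qed

lemma presented_generated: "generate (presented_group S Q) (gen_elem S Q ` S) = carrier (presented_group S Q)"
proof -
  interpret group "presented_group S Q" by (rule group_presented)
  have "word_class S Q v \<in> generate (presented_group S Q) (gen_elem S Q ` S)" if "set v \<subseteq> UNIV \<times> S" for v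
    using that
  proof (induction v)
    case Nil
    then show ?case using generate.one by (simp add: presented_one [symmetric])
  next
    case (Cons p v)
    obtain c x where p: "p = (c, x)" "x \<in> S" using Cons.prems by auto
    have "word_class S Q [p] \<in> generate (presented_group S Q) (gen_elem S Q ` S)"
    proof (cases c)
      case True
      then show ?thesis
        using p generate.incl [of "gen_elem S Q x" "gen_elem S Q ` S" "presented_group S Q"]
        by (simp add: gen_elem_def)
    next
      case False
      then show ?thesis
        using p generate.inv [of "gen_elem S Q x" "gen_elem S Q ` S" "presented_group S Q"] by (simp add: presented_inv_gen)
    qed
    then have "word_class S Q [p] \<otimes>\<^bsub>presented_group S Q\<^esub> word_class S Q v
        \<in> generate (presented_group S Q) (gen_elem S Q ` S)"
      using Cons by (intro generate.eng) auto
    then show ?case using Cons.prems by (simp add: presented_mult)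
  qed
  moreover have "gen_elem S Q ` S \<subseteq> carrier (presented_group S Q)"
    by (auto simp: gen_elem_closed)
  ultimately show ?thesis
    using generate_incl [of "gen_elem S Q ` S"] by (intro equalityI subsetI) (auto simp: presented_carrier)
qed

lemma presented_relator:
  assumes "x \<in> S" "y \<in> S" "z \<in> S"
    and "[(True, x), (True, y), (True, z)] @ inv_word [(True, z), (True, y), (True, x)] \<in> Q"
  shows "gen_elem S Q x \<otimes>\<^bsub>presented_group S Q\<^esub> gen_elem S Q y \<otimes>\<^bsub>presented_group S Q\<^esub> gen_elem S Q z =
    gen_elem S Q z \<otimes>\<^bsub>presented_group S Q\<^esub> gen_elem S Q y \<otimes>\<^bsub>presented_group S Q\<^esub> gen_elem S Q x"
proof -
  let ?w = "[(True, z), (True, y), (True, x)]"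
  have "pres_rel Q ([(True, x), (True, y), (True, z)] @ (inv_word ?w @ ?w)) ([(True, x), (True, y), (True, z)] @ [])"
    by (intro pres_rel_append pres_rel.refl pres_rel_inv_word)
  moreover have "pres_rel Q (([(True, x), (True, y), (True, z)] @ inv_word ?w) @ ?w) ([] @ ?w)"
    using pres_rel.relator [OF assms(4), of "[]" ?w] by simp
  ultimately have "pres_rel Q [(True, x), (True, y), (True, z)] ?w"
    by (simp only: append_assoc append_Nil append_Nil2) (blast intro: pres_rel.sym pres_rel.trans)
  then show ?thesis using assms(1-3) by (simp add: gen_elem_def presented_mult word_class_eq_iff)
qed

text \<open>The target is only a monoid, later the multiplicative monoid of a ring, so the values of
  inverse letters are supplied by a second map.\<close>

definition wval :: "('g \<Rightarrow> 'r::monoid_mult) \<Rightarrow> ('g \<Rightarrow> 'r) \<Rightarrow> 'g word \<Rightarrow> 'r" where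
  "wval \<phi> \<psi> w = prod_list (map (\<lambda>(c, x). if c then \<phi> x else \<psi> x) w)"

lemma pres_rel_wval:
  assumes "pres_rel Q v w" "\<And>x. \<phi> x * \<psi> x = 1" "\<And>x. \<psi> x * \<phi> x = 1"
    "\<And>r. r \<in> Q \<Longrightarrow> wval \<phi> \<psi> r = 1"
  shows "wval \<phi> \<psi> v = wval \<phi> \<psi> w"
  using assms(1)
proof (induction rule: pres_rel.induct)
  case (cancel u c x v)
  have "wval \<phi> \<psi> [(c, x), (\<not> c, x)] = 1" using assms by (simp add: wval_def)
  then show ?case by (simp add: wval_def mult.assoc [symmetric])
next
  case (relator r u v)
  then have "wval \<phi> \<psi> r = 1" using assms by simp
  then show ?case by (simp add: wval_def)
qed auto

definition pres_hom :: "('g \<Rightarrow> 'r::monoid_mult) \<Rightarrow> ('g \<Rightarrow> 'r) \<Rightarrow> 'g word set \<Rightarrow> 'r" where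
  "pres_hom \<phi> \<psi> P = wval \<phi> \<psi> (SOME w. w \<in> P)"

lemma pres_hom_class:
  assumes "\<And>x. \<phi> x * \<psi> x = 1" "\<And>x. \<psi> x * \<phi> x = 1" "\<And>r. r \<in> Q \<Longrightarrow> wval \<phi> \<psi> r = 1"
    and "set v \<subseteq> UNIV \<times> S"
  shows "pres_hom \<phi> \<psi> (word_class S Q v) = wval \<phi> \<psi> v"
proof -
  have "v \<in> word_class S Q v" using assms(4) by (simp add: word_class_def pres_rel.refl)
  then have "(SOME w. w \<in> word_class S Q v) \<in> word_class S Q v" by (rule someI)
  then have "pres_rel Q v (SOME w. w \<in> word_class S Q v)" by (simp add: word_class_def)
  then show ?thesis
    using pres_rel_wval assms(1-3) unfolding pres_hom_def by metis
qed


section \<open>Faithfulness of a semidirect product representation\<close>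

text \<open>The elimination writes t as the sum of a term in the letters of type 'y and a term in those of type
  'x. The representation S' kills 'x and thereby detects the first summand.\<close>
lemma elim_faithful:
  fixes \<delta> :: "'y::countable \<Rightarrow> 'x::countable \<Rightarrow> 'x lterm" and sp :: "'g \<Rightarrow> 'y + 'x lterm"
    and mx :: "'x \<Rightarrow> 'l::lie"
  assumes D: "\<And>x y. br (RT x) (D y) = ev RT (\<delta> y x)"
    and m: "\<And>x y. br (mx x) (my y) = ev mx (\<delta> y x)"
    and S: "ev (\<lambda>g. case sp g of Inl y \<Rightarrow> D y | Inr s \<Rightarrow> ev RT s) t = 0"
    and S': "ev (\<lambda>g. case sp g of Inl y \<Rightarrow> RT y | Inr s \<Rightarrow> 0) t = 0"
  shows "ev (\<lambda>g. case sp g of Inl y \<Rightarrow> my y | Inr s \<Rightarrow> ev mx s) t = 0"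
proof -
  let ?d = "fst (elim \<delta> sp t)" and ?t = "snd (elim \<delta> sp t)"
  have "ev RT ?d = 0"
    using S' ev_elim [of "\<lambda>_. 0" RT \<delta> sp t] by (simp cong: sum.case_cong)
  \<comment> \<open>The operators \<open>D y\<close> need not be free. Faithfulness of
    \<open>RT\<close> is what transfers the vanishing to them and to \<open>my\<close>.\<close>
  then have d: "ev my ?d = 0" "ev D ?d = 0"
    by (rule ev_RT_faithful)+
  have "ev RT ?t = 0"
    using S ev_elim [of RT D \<delta> sp t] D d by simp
  then have "ev mx ?t = 0" by (rule ev_RT_faithful)
  then show ?thesis
    using ev_elim [of mx my \<delta> sp t] m d by simp
qed

section \<open>Inverses of power series with constant term one\<close>

definition uinv :: "'r::ring_1 fps \<Rightarrow> 'r fps" where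
  "uinv F = fps_right_inverse F 1"

lemma uinv:
  fixes F :: "'r::ring_1 fps"
  assumes "F $ 0 = 1"
  shows "F * uinv F = 1" "uinv F * F = 1" "uinv F $ 0 = 1"
proof -
  show 1: "F * uinv F = 1"
    unfolding uinv_def using assms by (intro fps_right_inverse) simp
  show "uinv F $ 0 = 1" by (simp add: uinv_def)
  have "fps_left_inverse F 1 * F = 1"
    using assms by (intro fps_left_inverse) simp
  then show "uinv F * F = 1"
    using 1 by (metis mult.assoc mult_1 mult_1_right)
qed

lemma uinv_1:
  fixes F :: "'r::ring_1 fps"
  assumes "F $ 0 = 1"
  shows "uinv F $ 1 = - (F $ 1)"
  using arg_cong [OF uinv(1) [OF assms], of "\<lambda>f. f $ 1"] assms uinv(3) [OF assms]
  by (simp add: fps_mult_nth eq_neg_iff_add_eq_0)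

lemma fps_mult_nth_0': "(F * H) $ 0 = F $ 0 * H $ 0"
  by (simp add: fps_mult_nth)

lemma fps_mult_nth_1': "(F * H) $ Suc 0 = F $ 0 * H $ Suc 0 + F $ Suc 0 * H $ 0"
  by (simp add: fps_mult_nth)

section \<open>The representation of the group\<close>

datatype wlet = Wb1 | Wb2 | Wu | Wz "bool list"

instance wlet :: countable by countable_datatype

datatype gen = GA1 | GB1 | GA2 | GB2 | GC1 | GC2

text \<open>With u = b2 c1^-1 b1 the group is the free product of (F(b1, b2, u) extended by F(a1, a2)) and
  the cyclic group generated by z = c2. The kernel of the projection to F(a1, a2) is free on b1, b2, u
  and the conjugates Wz w of z. The letters False and True stand for a1 and a2.\<close>
fun wder :: "bool \<Rightarrow> wlet \<Rightarrow> wlet lterm" where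
  "wder y (Wz w) = LV (Wz (w @ [y]))"
| "wder False Wb2 = LB (LV Wb2) (LP (LV Wb1) (LN (LV Wu)))"
| "wder True Wb1 = LB (LV Wb1) (LP (LV Wb2) (LN (LV Wu)))"
| "wder y x = LZ"

text \<open>The value at \<open>GC1\<close> is the linear part of c1 = b1 u^-1 b2.\<close>

primrec wsplit :: "gen \<Rightarrow> bool + wlet lterm" where
  "wsplit GA1 = Inl False"
| "wsplit GB1 = Inr (LV Wb1)"
| "wsplit GA2 = Inl True"
| "wsplit GB2 = Inr (LV Wb2)"
| "wsplit GC1 = Inr (LP (LP (LV Wb1) (LN (LV Wu))) (LV Wb2))"
| "wsplit GC2 = Inr (LV (Wz []))"

definition XR :: "'a \<Rightarrow> 'a list endo fps" where
  "XR x = 1 + fps_X * fps_const (RT x)"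

lemma XR_nth [simp]: "XR x $ 0 = 1" "XR x $ Suc 0 = RT x"
  by (simp_all add: XR_def)

text \<open>Only the coefficient \<open>RT x\<close> of \<open>XR x\<close> is conjugated;
  \<open>1 + fps_X * wconj y x\<close> is then the conjugate of \<open>XR x\<close> when x is b1, b2
  or u. The constant term is \<open>RT x\<close>, as \<open>ex_intertwiner\<close> demands, and the
  linear term is \<open>wder y x\<close>. No relation constrains conjugates of z, so their linear
  term can be chosen to be the next letter.\<close>

fun wconj :: "bool \<Rightarrow> wlet \<Rightarrow> wlet list endo fps" where
  "wconj y (Wz w) = fps_const (RT (Wz w)) + fps_X * fps_const (RT (Wz (w @ [y])))"
| "wconj False Wb2 = XR Wu * uinv (XR Wb1) * fps_const (RT Wb2) * XR Wb1 * uinv (XR Wu)"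
| "wconj True Wb1 = uinv (XR Wb2) * XR Wu * fps_const (RT Wb1) * uinv (XR Wu) * XR Wb2"
| "wconj y x = fps_const (RT x)"

lemma wconj_0: "wconj y x $ 0 = RT x"
  by (cases "(y, x)" rule: wconj.cases) (simp_all add: fps_mult_nth_0' uinv)

lemma wconj_1: "wconj y x $ Suc 0 = ev RT (wder y x)"
  by (cases "(y, x)" rule: wconj.cases)
    (simp_all add: fps_mult_nth_0' fps_mult_nth_1' uinv uinv_1 [unfolded One_nat_def] br_endo_def algebra_simps)

definition rho :: "bool \<Rightarrow> wlet list endo fps" where
  "rho y = (SOME \<rho>. \<rho> $ 0 = 1 \<and> (\<forall>a. fps_const (RT a) * \<rho> = \<rho> * wconj y a))"

lemma rho: "rho y $ 0 = 1" "fps_const (RT a) * rho y = rho y * wconj y a"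
  using someI_ex [OF ex_intertwiner [of "wconj y"]] wconj_0 unfolding rho_def by blast+

text \<open>Comparing linear coefficients in the intertwining equation shows that the linearised
  action is the derivation used in the elimination.\<close>

lemma br_RT_rho: "br (RT x) (rho y $ Suc 0) = ev RT (wder y x)"
  using arg_cong [OF rho(2), of "\<lambda>f. f $ Suc 0" x y]
  by (simp add: fps_mult_nth_1' rho(1) wconj_0 wconj_1 br_endo_def algebra_simps)

lemma XR_rho: "XR x * rho y = rho y * (1 + fps_X * wconj y x)"
proof -
  have "XR x * rho y = rho y + fps_X * (fps_const (RT x) * rho y)"
    by (simp add: XR_def algebra_simps)
  also have "\<dots> = rho y + rho y * fps_X * wconj y x"
    by (simp add: rho(2) fps_mult_fps_X_commute mult.assoc [symmetric])
  finally show ?thesis by (simp add: algebra_simps)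
qed

lemma XR_rho_commute: "wconj y x = fps_const (RT x) \<Longrightarrow> XR x * rho y = rho y * XR x"
  unfolding XR_rho by (simp add: XR_def)

lemma conj_XR:
  assumes "k' * k = 1"
  shows "1 + fps_X * (k' * fps_const (RT x) * k) = k' * XR x * k"
proof -
  have "fps_X * (k' * fps_const (RT x) * k) = k' * (fps_X * fps_const (RT x)) * k"
    by (metis fps_mult_fps_X_commute mult.assoc)
  then show ?thesis using assms by (simp add: XR_def algebra_simps)
qed

lemma mult_inverse_mult:
  fixes a :: "'r::monoid_mult"
  assumes "a * a' = 1" "b * b' = 1"
  shows "a * b * (b' * a') = 1"
proof -
  have "a * b * (b' * a') = a * (b * b') * a'" by (simp only: mult.assoc)
  then show ?thesis using assms by simp
qed

lemma XR_rho_False: "XR Wb2 * rho False = rho False * (XR Wu * uinv (XR Wb1) * XR Wb2 * XR Wb1 * uinv (XR Wu))"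
proof -
  have "XR Wu * uinv (XR Wb1) * (XR Wb1 * uinv (XR Wu)) = 1"
    by (intro mult_inverse_mult) (simp_all add: uinv)
  from conj_XR [OF this, of Wb2] show ?thesis
    unfolding XR_rho by (simp add: mult.assoc)
qed

lemma XR_rho_True: "XR Wb1 * rho True = rho True * (uinv (XR Wb2) * XR Wu * XR Wb1 * uinv (XR Wu) * XR Wb2)"
proof -
  have "uinv (XR Wb2) * XR Wu * (uinv (XR Wu) * XR Wb2) = 1"
    by (intro mult_inverse_mult) (simp_all add: uinv)
  from conj_XR [OF this, of Wb1] show ?thesis
    unfolding XR_rho by (simp add: mult.assoc)
qed

text \<open>Values of the six generators lam i j for given values z, b1, b2, u, a1, a2, where upper case
  letters are inverses, with c1 = b1 u^-1 b2.\<close>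
locale pv3_values =
  fixes z b1 b2 u a1 a2 Z B1 B2 U A1 A2 :: "'r::monoid_mult"
  assumes inverses: "z * Z = 1" "Z * z = 1" "b1 * B1 = 1" "B1 * b1 = 1" "b2 * B2 = 1" "B2 * b2 = 1"
      "u * U = 1" "U * u = 1" "a1 * A1 = 1" "A1 * a1 = 1" "a2 * A2 = 1" "A2 * a2 = 1"
    and conj: "b1 * a1 = a1 * b1" "u * a1 = a1 * u" "b2 * a1 = a1 * (u * B1 * b2 * b1 * U)"
      "b2 * a2 = a2 * b2" "u * a2 = a2 * u" "b1 * a2 = a2 * (B2 * u * b1 * U * b2)"
begin

text \<open>Obtained by solving a1 = l13 l23, b1 = l13 l12, a2 = l32 l31, b2 = l21 l31, c1 = l13
  l31, c2 = l13 for the six lij, with c1^-1 = \<open>B2 * u * B1\<close>. The default 1 keeps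
  \<open>vinv\<close> a total inverse.\<close>

definition val :: "nat \<times> nat \<Rightarrow> 'r" where
  "val p = (if p = (1,3) then z else if p = (3,1) then Z * (b1 * U * b2)
     else if p = (2,3) then Z * a1 else if p = (1,2) then Z * b1
     else if p = (3,2) then a2 * (B2 * u * B1) * z
     else if p = (2,1) then b2 * (B2 * u * B1) * z else 1)"

definition vinv :: "nat \<times> nat \<Rightarrow> 'r" where
  "vinv p = (if p = (1,3) then Z else if p = (3,1) then (B2 * u * B1) * z
     else if p = (2,3) then A1 * z else if p = (1,2) then B1 * z
     else if p = (3,2) then Z * (b1 * U * b2) * A2
     else if p = (2,1) then Z * (b1 * U * b2) * B2 else 1)"

lemma inverses': "z * (Z * x) = x" "Z * (z * x) = x" "b1 * (B1 * x) = x" "B1 * (b1 * x) = x" "b2 * (B2 * x) = x"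
  "B2 * (b2 * x) = x" "u * (U * x) = x" "U * (u * x) = x" "a1 * (A1 * x) = x" "A1 * (a1 * x) = x"
  "a2 * (A2 * x) = x" "A2 * (a2 * x) = x"
  by (simp_all add: mult.assoc [symmetric] inverses)

lemma val_vinv: "val p * vinv p = 1" "vinv p * val p = 1"
  by (simp_all add: val_def vinv_def mult.assoc inverses inverses')

lemma conj_inverse:
  assumes "x * a = a * y" "X * x = 1" "y * Y = 1"
  shows "X * a = a * (Y :: 'r)"
  using assms by (metis mult.assoc mult_1 mult_1_right)

lemmas conj' = conj_inverse [OF conj(1) inverses(4) inverses(3)]
  conj_inverse [OF conj(2) inverses(8) inverses(7)]
  conj_inverse [OF conj(4) inverses(6) inverses(5)]
  conj_inverse [OF conj(5) inverses(8) inverses(7)]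

lemma conj_B2: "B2 * a1 = a1 * (u * B1 * B2 * b1 * U)"
  by (rule conj_inverse [OF conj(3) inverses(6)]) (simp add: mult.assoc inverses inverses')

lemma conj_B1: "B1 * a2 = a2 * (B2 * u * B1 * U * b2)"
  by (rule conj_inverse [OF conj(6) inverses(4)]) (simp add: mult.assoc inverses inverses')

text \<open>Read from left to right, these rules carry a1 and a2 to the left past b1, b2, u and
  their inverses, as in a normal form for a semidirect product. Free cancellation then decides the
  relations.\<close>

lemmas moves = conj conj' conj_B1 conj_B2

lemma moves': "x * a = a * y \<Longrightarrow> x * (a * w) = a * (y * (w :: 'r))"
  by (metis mult.assoc)

lemma val_relation:
  assumes "{k, i, j} = {1, 2, 3}" "distinct [k, i, j]"
  shows "val (k, i) * val (k, j) * val (i, j) = val (i, j) * val (k, j) * val (k, i)"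
proof -
  have val: "val (1,3) = z" "val (3,1) = Z * (b1 * U * b2)" "val (2,3) = Z * a1" "val (1,2) = Z * b1"
    "val (3,2) = a2 * (B2 * u * B1) * z" "val (2,1) = b2 * (B2 * u * B1) * z"
    by (simp_all add: val_def)
  have rel: "val (1,2) * val (1,3) * val (2,3) = val (2,3) * val (1,3) * val (1,2)"
    "val (1,3) * val (1,2) * val (3,2) = val (3,2) * val (1,2) * val (1,3)"
    "val (2,1) * val (2,3) * val (1,3) = val (1,3) * val (2,3) * val (2,1)"
    "val (2,3) * val (2,1) * val (3,1) = val (3,1) * val (2,1) * val (2,3)"
    "val (3,1) * val (3,2) * val (1,2) = val (1,2) * val (3,2) * val (3,1)"
    "val (3,2) * val (3,1) * val (2,1) = val (2,1) * val (3,1) * val (3,2)"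
    unfolding val
    by (simp_all only: mult.assoc mult_1 mult_1_right inverses inverses' moves moves [THEN moves'])
  have "k \<in> {1, 2, 3}" "i \<in> {1, 2, 3}" "j \<in> {1, 2, 3}" using assms(1) by blast+
  then show ?thesis using assms(2) rel by (elim insertE) simp_all
qed

end


section \<open>Unipotent representations of a group\<close>

definition unip :: "nat \<Rightarrow> 'r::ring_1 fps \<Rightarrow> bool" where
  "unip n F \<longleftrightarrow> F $ 0 = 1 \<and> (\<forall>i. 0 < i \<and> i < n \<longrightarrow> F $ i = 0)"

lemma fps_mult_nth_low:
  fixes f g :: "'r::ring_1 fps"
  assumes "\<And>i. i < m \<Longrightarrow> f $ i = 0" "\<And>i. i < n \<Longrightarrow> g $ i = 0"
  shows "k < m + n \<Longrightarrow> (f * g) $ k = 0" "(f * g) $ (m + n) = f $ m * g $ n"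
proof -
  have *: "f $ i * g $ (k - i) = 0" if "i \<le> k" "k \<le> m + n" "i \<noteq> m \<or> k < m + n" for i k
    using that assms by (cases "i < m"; cases "k - i < n") auto
  show "k < m + n \<Longrightarrow> (f * g) $ k = 0"
    by (auto simp: fps_mult_nth * intro!: sum.neutral)
  have "(f * g) $ (m + n) = (\<Sum>i\<in>{m}. f $ i * g $ (m + n - i))"
    unfolding fps_mult_nth by (rule sum.mono_neutral_right) (auto intro!: *)
  then show "(f * g) $ (m + n) = f $ m * g $ n" by simp
qed

lemma unip_mult_nth:
  fixes F H :: "'r::ring_1 fps"
  assumes "unip n F" "unip n H" "0 < n"
  shows "unip n (F * H)" "(F * H) $ n = F $ n + H $ n"
proof -
  have low: "(F - 1) $ i = 0" "(H - 1) $ i = 0" if "i < n" for i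
    using assms that by (auto simp: unip_def)
  have FH: "F * H = 1 + (F - 1) + (H - 1) + (F - 1) * (H - 1)" by (simp add: algebra_simps)
  have "((F - 1) * (H - 1)) $ i = 0" if "i \<le> n" for i
    using fps_mult_nth_low(1) [of n "F - 1" n "H - 1" i] low that \<open>0 < n\<close> by simp
  then have "(F * H) $ i = (1 + (F - 1) + (H - 1)) $ i" if "i \<le> n" for i
    using that by (subst FH) simp
  then show "unip n (F * H)" "(F * H) $ n = F $ n + H $ n"
    using assms by (auto simp: unip_def)
qed

locale unipotent_rep = group G for G :: "('a, 'b) monoid_scheme" (structure) +
  fixes r :: "'a \<Rightarrow> 'w endo fps"
  assumes r_mult: "x \<in> carrier G \<Longrightarrow> y \<in> carrier G \<Longrightarrow> r (x \<otimes> y) = r x * r y"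
    and r_one: "r \<one> = 1"
    and r_0: "x \<in> carrier G \<Longrightarrow> r x $ 0 = 1"
begin

lemma r_inv: "x \<in> carrier G \<Longrightarrow> r (inv x) * r x = 1"
  by (simp flip: r_mult r_one)

lemma r_inv': "x \<in> carrier G \<Longrightarrow> r (inv x) * (r x * F) = F"
  by (simp add: r_inv flip: mult.assoc)

lemma r_gcomm:
  assumes "x \<in> carrier G" "y \<in> carrier G"
  shows "r (gcomm G x y) = 1 + r (inv x) * r (inv y) * (r x * r y - r y * r x)"
  using assms by (simp add: gcomm_def r_mult algebra_simps r_inv' r_inv)

text \<open>The difference xy - yx equals the commutator of x - 1 and y - 1, so it starts in degree
  m + n with the bracket of the leading coefficients. The factor x^-1 y^-1 in front contributes only
  its constant term 1 there.\<close>

lemma gcomm_nth: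
  assumes "x \<in> carrier G" "y \<in> carrier G" "unip m (r x)" "unip n (r y)" "0 < m" "0 < n"
  shows "unip (m + n) (r (gcomm G x y))" "r (gcomm G x y) $ (m + n) = br (r x $ m) (r y $ n)"
proof -
  let ?f = "r x - 1" and ?g = "r y - 1"
  have low: "?f $ i = 0" if "i < m" for i using assms that by (auto simp: unip_def)
  have low': "?g $ i = 0" if "i < n" for i using assms that by (auto simp: unip_def)
  define h where "h = ?f * ?g - ?g * ?f"
  have h: "r x * r y - r y * r x = h" by (simp add: h_def algebra_simps)
  have h0: "h $ i = 0" if "i < m + n" for i
    using fps_mult_nth_low(1) [OF low low'] fps_mult_nth_low(1) [OF low' low] that
    by (simp add: h_def add.commute)
  have hn: "h $ (m + n) = br (r x $ m) (r y $ n)"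
    using fps_mult_nth_low(2) [of m ?f n ?g] fps_mult_nth_low(2) [of n ?g m ?f] low low' assms(5,6)
    by (simp add: h_def br_endo_def add.commute)
  define e where "e = r (inv x) * r (inv y)"
  have e0: "e $ 0 = 1" using assms by (simp add: e_def fps_mult_nth r_0)
  have eh: "(e * h) $ i = 0" if "i < m + n" for i
    using fps_mult_nth_low(1) [of 0 e "m + n" h i] h0 that by simp
  have ehn: "(e * h) $ (m + n) = br (r x $ m) (r y $ n)"
    using fps_mult_nth_low(2) [of 0 e "m + n" h] h0 hn e0 by simp
  have *: "r (gcomm G x y) = 1 + e * h" using assms by (simp add: r_gcomm h e_def)
  show "unip (m + n) (r (gcomm G x y))" "r (gcomm G x y) $ (m + n) = br (r x $ m) (r y $ n)"
    using eh ehn h0 [of 0] assms(5,6) by (auto simp: * unip_def)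
qed

lemma unip_inv:
  assumes "x \<in> carrier G" "unip n (r x)"
  shows "unip n (r (inv x))"
proof -
  have "r (inv x) $ i = 0" if "0 < i" "i < n" for i
    using that
  proof (induction i rule: less_induct)
    case (less i)
    have "(r (inv x) * r x) $ i = 0" using assms less.prems by (simp add: r_inv)
    moreover have "(r (inv x) * r x) $ i = (\<Sum>j\<in>{i}. r (inv x) $ j * r x $ (i - j))"
      unfolding fps_mult_nth
      by (rule sum.mono_neutral_right)
        (use assms less.prems in \<open>auto simp: unip_def\<close>)
    ultimately show ?case using assms by (simp add: r_0)
  qed
  then show ?thesis using assms by (simp add: unip_def r_0)
qed

lemma unip_lcs: "x \<in> lcs G n \<Longrightarrow> 0 < n \<Longrightarrow> unip n (r x)"
proof (induction n arbitrary: x)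
  case (Suc n)
  show ?case
  proof (cases "n = 0")
    case True
    then show ?thesis using Suc.prems by (auto simp: unip_def r_0)
  next
    case False
    let ?H = "{gcomm G x y |x y. x \<in> lcs G n \<and> y \<in> carrier G}"
    have H: "h \<in> carrier G \<and> unip (Suc n) (r h)" if "h \<in> ?H" for h
    proof -
      obtain x y where h: "h = gcomm G x y" "x \<in> lcs G n" "y \<in> carrier G"
        using \<open>h \<in> ?H\<close> by blast
      have "unip 1 (r y)" using h by (auto simp: unip_def r_0)
      then show ?thesis using gcomm_nth(1) [of x y n 1] h Suc.IH [of x] False by simp
    qed
    have "x \<in> generate G ?H" using Suc.prems False by (simp add: lcs_Suc)
    then have "x \<in> carrier G \<and> unip (Suc n) (r x)"
    proof (induction rule: generate.induct)
      case one
      show ?case by (simp add: r_one unip_def)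
    next
      case (incl h)
      then show ?case using H by blast
    next
      case (inv h)
      then show ?case using H [of h] unip_inv by simp
    next
      case (eng h1 h2)
      then show ?case by (simp add: r_mult unip_mult_nth)
    qed
    then show ?thesis ..
  qed
qed simp

text \<open>Degree 0 is set to 0 because component 0 of a graded element is the empty set, whose
  chosen representative is arbitrary.\<close>

definition lead :: "nat \<Rightarrow> 'a \<Rightarrow> 'w endo" where
  "lead n x = (if n = 0 then 0 else r x $ n)"

lemma lead_mult: "x \<in> lcs G n \<Longrightarrow> y \<in> lcs G n \<Longrightarrow> lead n (x \<otimes> y) = lead n x + lead n y"
  by (simp add: lead_def r_mult unip_mult_nth unip_lcs)

lemma lead_zero: "x \<in> lcs G (Suc n) \<Longrightarrow> lead n x = 0"
  using unip_lcs [of x "Suc n"] by (simp add: lead_def unip_def)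

lemma lead_cong:
  assumes "cl n x = cl n y" "x \<in> lcs G n" "y \<in> lcs G n"
  shows "lead n x = lead n y"
proof -
  have "x \<otimes> inv y \<in> lcs G (Suc n)" using assms by (simp add: cl_eq_iff)
  then have "lead n (x \<otimes> inv y) = 0" by (rule lead_zero)
  moreover have "lead n (x \<otimes> inv y \<otimes> y) = lead n (x \<otimes> inv y) + lead n y"
    using assms by (intro lead_mult) auto
  ultimately show ?thesis using assms by (simp add: m_assoc)
qed

text \<open>The leading coefficients of all degrees are added in one endomorphism ring. Forgetting
  the grading is harmless, since the faithfulness result concerns ungraded Lie terms.\<close>

definition gr_rep :: "(nat \<Rightarrow> 'a set) \<Rightarrow> 'w endo" where
  "gr_rep f = Sum_any (\<lambda>n. lead n (coset_rep (f n)))"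

lemma gr_rep_mk:
  assumes "fam X"
  shows "gr_rep (mk X) = Sum_any (\<lambda>n. lead n (X n))" "finite {n. lead n (X n) \<noteq> 0}"
proof -
  have "lead n (coset_rep (mk X n)) = lead n (X n)" for n
  proof (cases "n = 0")
    case False
    have "mk X n \<in> lcs_quot G n"
      using mk_closed [OF assms] False by (auto simp: assoc_graded_def)
    from coset_rep_lcs_quot [OF this] False fam_lcs [OF assms, of n] show ?thesis
      by (intro lead_cong) (auto simp: mk_def)
  qed (simp add: lead_def)
  then show "gr_rep (mk X) = Sum_any (\<lambda>n. lead n (X n))" by (simp add: gr_rep_def)
  obtain N where N: "\<And>n. n > N \<Longrightarrow> X n \<in> lcs G (Suc n)" using assms by (auto simp: fam_def)
  have "{n. lead n (X n) \<noteq> 0} \<subseteq> {..N}"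
  proof
    fix n assume "n \<in> {n. lead n (X n) \<noteq> 0}"
    then have "\<not> n > N" using N lead_zero by blast
    then show "n \<in> {..N}" by simp
  qed
  then show "finite {n. lead n (X n) \<noteq> 0}" by (rule finite_subset) simp
qed

lemma gr_rep_add:
  assumes "f \<in> lcarrier (assoc_graded G)" "g \<in> lcarrier (assoc_graded G)"
  shows "gr_rep (ladd (assoc_graded G) f g) = gr_rep f + gr_rep g"
proof -
  obtain X Y where fam: "fam X" "fam Y" and mk: "f = mk X" "g = mk Y"
    using assms mk_cases by metis
  have "lead n (X n \<otimes> Y n) = lead n (X n) + lead n (Y n)" for n
    using fam by (cases "n = 0") (simp_all add: lead_mult fam_lcs, simp add: lead_def)
  then show ?thesis
    using fam by (simp add: mk ladd_mk gr_rep_mk fam_mult Sum_any.distrib)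
qed

lemma gr_rep_hel:
  assumes "x \<in> lcs G n"
  shows "gr_rep (hel n x) = lead n x"
proof -
  have eq: "(\<lambda>k. lead k (if k = n then x else \<one>)) = (\<lambda>k. if k = n then lead n x else 0)"
    using lead_zero [OF lcs_one] by auto
  have "gr_rep (hel n x) = Sum_any (\<lambda>k. lead k (if k = n then x else \<one>))"
    by (simp only: hel_def gr_rep_mk(1) [OF fam_hel [OF assms]])
  also have "\<dots> = lead n x"
    using arg_cong [OF eq, of Sum_any] by simp
  finally show ?thesis .
qed

lemma gr_rep_zero: "gr_rep (lzero (assoc_graded G)) = 0"
  using gr_rep_hel [OF lcs_one, of 0] by (simp add: hel_one lead_def)

interpretation LG: bilinear_ring "assoc_graded G"
  by (rule bilinear_assoc_graded)

lemma gr_rep_br: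
  assumes "f \<in> lcarrier (assoc_graded G)" "g \<in> lcarrier (assoc_graded G)"
  shows "gr_rep (lbr (assoc_graded G) f g) = br (gr_rep f) (gr_rep g)"
  using assms(1)
proof (induction rule: assoc_graded_induct)
  case zero
  then show ?case using assms by (simp add: LG.lbr_zero_left gr_rep_zero)
next
  case (hel m x)
  show ?case
    using assms(2)
  proof (induction rule: assoc_graded_induct)
    case zero
    then show ?case using hel by (simp add: LG.lbr_zero_right gr_rep_zero hel_closed)
  next
    case (hel n y)
    then have "gcomm G x y \<in> lcs G (m + n)"
      using \<open>0 < m\<close> \<open>x \<in> lcs G m\<close> by (intro gcomm_lcs)
    then show ?case
      using hel \<open>0 < m\<close> \<open>x \<in> lcs G m\<close> gcomm_nth(2) [of x y m n]
      by (simp add: hel_bracket gr_rep_hel lead_def unip_lcs)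
  next
    case (add f g)
    then show ?case
      using hel by (simp add: LG.lbr_add_right hel_closed gr_rep_add LG.lbr_closed br_add_right)
  qed
next
  case (add f f')
  then show ?case
    using assms(2) by (simp add: LG.lbr_add_left gr_rep_add LG.lbr_closed br_add_left)
qed

lemma gr_rep_neg:
  assumes "f \<in> lcarrier (assoc_graded G)"
  shows "gr_rep (LG.lneg f) = - gr_rep f"
  using gr_rep_add [OF LG.lneg_closed [OF assms] assms] LG.lneg_add [OF assms]
  by (simp add: gr_rep_zero eq_neg_iff_add_eq_0)

end


section \<open>Evaluation of Lie terms in Lie rings given as records\<close>

text \<open>The counterpart of \<open>ev\<close> for Lie rings carried by a set: both the graded
  ring and the arbitrary target of the universal property are records, not instances of the class
  \<open>lie\<close>.\<close>

primrec evr :: "('m, 'b) liering_scheme \<Rightarrow> ('a \<Rightarrow> 'm) \<Rightarrow> 'a lterm \<Rightarrow> 'm" where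
  "evr L m LZ = lzero L"
| "evr L m (LV x) = m x"
| "evr L m (LN t) = bilinear_ring.lneg L (evr L m t)"
| "evr L m (LP t s) = ladd L (evr L m t) (evr L m s)"
| "evr L m (LB t s) = lbr L (evr L m t) (evr L m s)"

context bilinear_ring
begin

lemma evr_closed: "(\<And>x. m x \<in> lcarrier L) \<Longrightarrow> evr L m t \<in> lcarrier L"
  by (induction t) (simp_all add: A.one_closed A.m_closed lneg_closed lbr_closed)

lemma lbr_neg_left:
  assumes "x \<in> lcarrier L" "y \<in> lcarrier L"
  shows "lbr L (lneg x) y = lneg (lbr L x y)"
proof (rule lneg_eqI)
  have "ladd L (lbr L (lneg x) y) (lbr L x y) = lbr L (ladd L (lneg x) x) y"
    using assms by (simp add: lbr_add_left lneg_closed)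
  then show "ladd L (lbr L (lneg x) y) (lbr L x y) = lzero L"
    using assms by (simp add: lneg_add lbr_zero_left)
qed (use assms in \<open>simp_all add: lbr_closed lneg_closed\<close>)

lemma lneg_inject: "x \<in> lcarrier L \<Longrightarrow> y \<in> lcarrier L \<Longrightarrow> lneg x = lneg y \<Longrightarrow> x = y"
  unfolding lneg_def using A.inv_inv by metis

end

lemma hom_evr:
  assumes L: "bilinear_ring L" and M: "bilinear_ring M" and h: "lie_hom L M h"
    and m: "\<And>x. m x \<in> lcarrier L"
  shows "h (evr L m t) = evr M (\<lambda>x. h (m x)) t"
proof -
  interpret L: bilinear_ring L by (rule L)
  interpret M: bilinear_ring M by (rule M)
  have closed: "h x \<in> lcarrier M" if "x \<in> lcarrier L" for x
    using h that by (simp add: lie_hom_def)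
  have add: "h (ladd L x y) = ladd M (h x) (h y)" and br: "h (lbr L x y) = lbr M (h x) (h y)"
    if "x \<in> lcarrier L" "y \<in> lcarrier L" for x y
    using h that by (simp_all add: lie_hom_def)
  have c: "evr L m t \<in> lcarrier L" for t using m by (rule L.evr_closed)
  have zero: "h (lzero L) = lzero M"
    using add [of "lzero L" "lzero L"] closed [of "lzero L"] by (simp add: L.A_simps)
  have neg: "h (L.lneg x) = M.lneg (h x)" if "x \<in> lcarrier L" for x
    using add [of "L.lneg x" x] that
    by (intro M.lneg_eqI) (simp_all add: L.lneg_closed closed L.lneg_add zero)
  show ?thesis
    by (induction t) (simp_all add: zero neg add br c)
qed

section \<open>The presented Lie ring\<close>

definition lie_relators :: "(gen lterm \<times> gen lterm) set" where
  "lie_relators =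
    {(LB (LV GA1) (LV GB1), LZ), (LB (LV GA2) (LV GB2), LZ),
     (LB (LV GC1) (LV GB1), LB (LV GA2) (LV GB1)), (LB (LV GC1) (LV GA1), LB (LV GB2) (LV GA1)),
     (LB (LV GC1) (LV GB2), LB (LV GA1) (LV GB2)), (LB (LV GC1) (LV GA2), LB (LV GB1) (LV GA2))}"

inductive leq :: "gen lterm \<Rightarrow> gen lterm \<Rightarrow> bool" where
  leq_refl: "leq s s"
| leq_sym: "leq s t \<Longrightarrow> leq t s"
| leq_trans: "leq s t \<Longrightarrow> leq t u \<Longrightarrow> leq s u"
| leq_LN: "leq s t \<Longrightarrow> leq (LN s) (LN t)"
| leq_LP: "leq s t \<Longrightarrow> leq s' t' \<Longrightarrow> leq (LP s s') (LP t t')"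
| leq_LB: "leq s t \<Longrightarrow> leq s' t' \<Longrightarrow> leq (LB s s') (LB t t')"
| leq_assoc: "leq (LP (LP a b) c) (LP a (LP b c))"
| leq_comm: "leq (LP a b) (LP b a)"
| leq_zero: "leq (LP LZ a) a"
| leq_neg: "leq (LP (LN a) a) LZ"
| leq_left: "leq (LB (LP a b) c) (LP (LB a c) (LB b c))"
| leq_right: "leq (LB c (LP a b)) (LP (LB c a) (LB c b))"
| leq_self: "leq (LB a a) LZ"
| leq_jacobi: "leq (LP (LP (LB a (LB b c)) (LB b (LB c a))) (LB c (LB a b))) LZ"
| leq_relator: "(s, t) \<in> lie_relators \<Longrightarrow> leq s t"

\<comment> \<open>Making the presented Lie ring an instance of \<open>lie\<close> turns derivability
  from the relators into vanishing of an evaluation, to which the faithfulness result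
  applies.\<close>
quotient_type pv_lie = "gen lterm" / leq
  by (rule equivpI) (auto simp: reflp_def symp_def transp_def intro: leq_refl leq_sym leq_trans)

instantiation pv_lie :: lie
begin

lift_definition zero_pv_lie :: pv_lie is LZ .
lift_definition uminus_pv_lie :: "pv_lie \<Rightarrow> pv_lie" is LN by (rule leq_LN)
lift_definition plus_pv_lie :: "pv_lie \<Rightarrow> pv_lie \<Rightarrow> pv_lie" is LP by (rule leq_LP)
lift_definition minus_pv_lie :: "pv_lie \<Rightarrow> pv_lie \<Rightarrow> pv_lie" is "\<lambda>s t. LP s (LN t)"
  by (intro leq_LP leq_LN)
lift_definition br_pv_lie :: "pv_lie \<Rightarrow> pv_lie \<Rightarrow> pv_lie" is LB by (rule leq_LB)

instance
proof
  fix a b c :: pv_lie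
  show "a + b + c = a + (b + c)" by transfer (rule leq_assoc)
  show "a + b = b + a" by transfer (rule leq_comm)
  show "0 + a = a" by transfer (rule leq_zero)
  show "- a + a = 0" by transfer (rule leq_neg)
  show "a - b = a + - b" by transfer (rule leq_refl)
  show "br (a + b) c = br a c + br b c" by transfer (rule leq_left)
  show "br c (a + b) = br c a + br c b" by transfer (rule leq_right)
  show "br a a = 0" by transfer (rule leq_self)
  show "br a (br b c) + br b (br c a) + br c (br a b) = 0" by transfer (rule leq_jacobi)
qed

end

lemma ev_abs_pv_lie: "ev (\<lambda>g. abs_pv_lie (LV g)) t = abs_pv_lie t"
  by (induction t)
    (simp_all add: zero_pv_lie.abs_eq uminus_pv_lie.abs_eq plus_pv_lie.abs_eq br_pv_lie.abs_eq
      zero_pv_lie_def)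

lemma leq_if_ev_zero: "ev (\<lambda>g. abs_pv_lie (LV g)) t = 0 \<Longrightarrow> leq t LZ"
  unfolding ev_abs_pv_lie zero_pv_lie_def pv_lie.abs_eq_iff .

text \<open>Soundness of derivations in every Lie ring satisfying the relations. It carries
  equalities found in the graded ring over to the target.\<close>

lemma leq_sound:
  assumes M: "lie_ring M" and m: "\<And>g. m g \<in> lcarrier M"
    and rels: "PV3_lie_rels M (m GA1) (m GB1) (m GA2) (m GB2) (m GC1) (m GC2)"
    and "leq s t"
  shows "evr M m s = evr M m t"
proof -
  interpret M: bilinear_ring M by (rule lie_ring_bilinear) (rule M)
  have c: "evr M m t \<in> lcarrier M" for t using m by (rule M.evr_closed)
  show ?thesis
    using assms(4)
  proof (induction rule: leq.induct)
    case (leq_relator s t)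
    then show ?case using rels by (auto simp: lie_relators_def PV3_lie_rels_def)
  next
    case (leq_jacobi a b d)
    then show ?case using M c by (simp add: lie_ring_def)
  next
    case (leq_self a)
    then show ?case using M c by (simp add: lie_ring_def)
  qed (simp_all add: c M.A.m_ac M.lneg_add M.lbr_add_left M.lbr_add_right M.A.l_one)
qed

lemma gen_faithful:
  fixes m :: "gen \<Rightarrow> 'l::lie"
  assumes rels: "br (m GA1) (m GB1) = 0" "br (m GA2) (m GB2) = 0"
      "br (m GC1) (m GB1) = br (m GA2) (m GB1)" "br (m GC1) (m GA1) = br (m GB2) (m GA1)"
      "br (m GC1) (m GB2) = br (m GA1) (m GB2)" "br (m GC1) (m GA2) = br (m GB1) (m GA2)"
    and S: "ev (\<lambda>g. case wsplit g of Inl y \<Rightarrow> rho y $ Suc 0 | Inr s \<Rightarrow> ev RT s) t = 0"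
    and S': "ev (\<lambda>g. case wsplit g of Inl y \<Rightarrow> RT y | Inr s \<Rightarrow> 0) t = 0"
  shows "ev m t = 0"
proof -
  define my where "my y = (if y then m GA2 else m GA1)" for y
  \<comment> \<open>The inverse change of variables: u becomes b2 - c1 + b1, and the letter for a
    word in a1, a2 becomes the iterated bracket of c2 with it.\<close>
  define mx where "mx x = (case x of Wb1 \<Rightarrow> m GB1 | Wb2 \<Rightarrow> m GB2 | Wu \<Rightarrow> m GB2 - m GC1 + m GB1
      | Wz w \<Rightarrow> foldl br (m GC2) (map my w))" for x
  \<comment> \<open>Since b2 - u = c1 - b1 and b1 - u = c1 - b2, the derivations amount to [b1, a2]
    = [b1, c1] and [b2, a1] = [b2, c1]; the other relations make a1 and a2 commute with u.\<close>
  have anti: "br (m GB1) (m GA1) = 0" "br (m GB2) (m GA2) = 0"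
    "br (m GB1) (m GA2) = br (m GB1) (m GC1)" "br (m GB2) (m GA1) = br (m GB2) (m GC1)"
    using rels br_anti [of "m GB1" "m GA1"] br_anti [of "m GB2" "m GA2"]
      br_anti [of "m GB1" "m GA2"] br_anti [of "m GB1" "m GC1"]
      br_anti [of "m GB2" "m GA1"] br_anti [of "m GB2" "m GC1"] by simp_all
  have "br (mx x) (my y) = ev mx (wder y x)" for x y
    by (cases "(y, x)" rule: wder.cases)
      (simp_all add: mx_def my_def rels anti br_add_left br_add_right br_minus_right
        diff_conv_add_uminus br_minus_left del: add_uminus_conv_diff)
  from elim_faithful [OF br_RT_rho this S S']
  have "ev (\<lambda>g. case wsplit g of Inl y \<Rightarrow> my y | Inr s \<Rightarrow> ev mx s) t = 0" .
  moreover have "(case wsplit g of Inl y \<Rightarrow> my y | Inr s \<Rightarrow> ev mx s) = m g" for g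
    by (cases g) (simp_all add: my_def mx_def)
  ultimately show ?thesis by simp
qed

lemma leq_if_represented_zero:
  assumes "ev (\<lambda>g. case wsplit g of Inl y \<Rightarrow> rho y $ Suc 0 | Inr s \<Rightarrow> ev RT s) t = 0"
    and "ev (\<lambda>g. case wsplit g of Inl y \<Rightarrow> RT y | Inr s \<Rightarrow> 0) t = 0"
  shows "leq t LZ"
proof (rule leq_if_ev_zero, rule gen_faithful [OF _ _ _ _ _ _ assms])
  have "abs_pv_lie s = abs_pv_lie t" if "(s, t) \<in> lie_relators" for s t
    using that by (simp add: pv_lie.abs_eq_iff leq_relator)
  note rel = this [unfolded lie_relators_def]
  show "br (abs_pv_lie (LV GA1)) (abs_pv_lie (LV GB1)) = 0"
    "br (abs_pv_lie (LV GA2)) (abs_pv_lie (LV GB2)) = 0"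
    "br (abs_pv_lie (LV GC1)) (abs_pv_lie (LV GB1)) = br (abs_pv_lie (LV GA2)) (abs_pv_lie (LV GB1))"
    "br (abs_pv_lie (LV GC1)) (abs_pv_lie (LV GA1)) = br (abs_pv_lie (LV GB2)) (abs_pv_lie (LV GA1))"
    "br (abs_pv_lie (LV GC1)) (abs_pv_lie (LV GB2)) = br (abs_pv_lie (LV GA1)) (abs_pv_lie (LV GB2))"
    "br (abs_pv_lie (LV GC1)) (abs_pv_lie (LV GA2)) = br (abs_pv_lie (LV GB1)) (abs_pv_lie (LV GA2))"
    unfolding br_pv_lie.abs_eq zero_pv_lie_def by (rule rel, simp)+
qed

section \<open>The group PV3\<close>

interpretation PV3: group PV3
  unfolding PV3_def by (rule group_presented)

interpretation LG: bilinear_ring "assoc_graded PV3"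
  by (rule PV3.bilinear_assoc_graded)

lemma PV3_gens_mem: "(i, j) \<in> PV3_gens \<longleftrightarrow> i \<in> {1, 2, 3} \<and> j \<in> {1, 2, 3} \<and> i \<noteq> j"
  by (simp add: PV3_gens_def)

lemma lam_closed: "i \<in> {1, 2, 3} \<Longrightarrow> j \<in> {1, 2, 3} \<Longrightarrow> i \<noteq> j \<Longrightarrow> lam i j \<in> carrier PV3"
  unfolding lam_def PV3_def by (rule gen_elem_closed) (simp add: PV3_gens_mem)

lemma lam_relation:
  assumes "{k, i, j} = {1, 2, 3}" "distinct [k, i, j]"
  shows "lam k i \<otimes>\<^bsub>PV3\<^esub> lam k j \<otimes>\<^bsub>PV3\<^esub> lam i j = lam i j \<otimes>\<^bsub>PV3\<^esub> lam k j \<otimes>\<^bsub>PV3\<^esub> lam k i"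
proof -
  have mem: "k \<in> {1, 2, 3}" "i \<in> {1, 2, 3}" "j \<in> {1, 2, 3}" using assms(1) by blast+
  show ?thesis
    unfolding lam_def PV3_def
    by (rule presented_relator)
      (use assms mem in \<open>auto simp: PV3_gens_mem PV3_rels_def simp del: insert_iff\<close>)
qed

primrec gelt :: "gen \<Rightarrow> (nat \<times> nat) word set" where
  "gelt GA1 = lam 1 3 \<otimes>\<^bsub>PV3\<^esub> lam 2 3"
| "gelt GB1 = lam 1 3 \<otimes>\<^bsub>PV3\<^esub> lam 1 2"
| "gelt GA2 = lam 3 2 \<otimes>\<^bsub>PV3\<^esub> lam 3 1"
| "gelt GB2 = lam 2 1 \<otimes>\<^bsub>PV3\<^esub> lam 3 1"
| "gelt GC1 = lam 1 3 \<otimes>\<^bsub>PV3\<^esub> lam 3 1"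
| "gelt GC2 = lam 1 3"

lemma gelt_closed: "gelt g \<in> carrier PV3"
  by (cases g) (simp_all add: lam_closed)

context pv3_values
begin

definition hom :: "(nat \<times> nat) word set \<Rightarrow> 'r" where
  "hom = pres_hom val vinv"

lemma wval_relator: "w \<in> PV3_rels \<Longrightarrow> wval val vinv w = 1"
proof -
  assume "w \<in> PV3_rels"
  then obtain k i j where w: "w = [(True,(k,i)), (True,(k,j)), (True,(i,j))] @
      inv_word [(True,(i,j)), (True,(k,j)), (True,(k,i))]" and "{k, i, j} = {1, 2, 3}" "distinct [k, i, j]"
    by (auto simp: PV3_rels_def)
  then have "val (k, i) * val (k, j) * val (i, j) = val (i, j) * val (k, j) * val (k, i)"
    by (intro val_relation)
  then have "wval val vinv w =
      val (i, j) * val (k, j) * val (k, i) * (vinv (k, i) * (vinv (k, j) * vinv (i, j)))"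
    by (simp add: w wval_def inv_word_def mult.assoc [symmetric])
  also have "\<dots> = val (i, j) * (val (k, j) * (val (k, i) * vinv (k, i)) * vinv (k, j)) * vinv (i, j)"
    by (simp only: mult.assoc)
  finally show ?thesis by (simp add: val_vinv)
qed

lemma hom_class: "set v \<subseteq> UNIV \<times> PV3_gens \<Longrightarrow> hom (word_class PV3_gens PV3_rels v) = wval val vinv v"
  unfolding hom_def by (rule pres_hom_class) (auto simp: val_vinv wval_relator)

lemma hom_lam: "(i, j) \<in> PV3_gens \<Longrightarrow> hom (lam i j) = val (i, j)"
  by (simp add: lam_def gen_elem_def hom_class wval_def)

lemma hom_mult: "x \<in> carrier PV3 \<Longrightarrow> y \<in> carrier PV3 \<Longrightarrow> hom (x \<otimes>\<^bsub>PV3\<^esub> y) = hom x * hom y"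
  unfolding PV3_def by (auto simp: presented_carrier presented_mult hom_class wval_def)

lemma hom_one: "hom \<one>\<^bsub>PV3\<^esub> = 1"
  by (simp add: PV3_def presented_one hom_class wval_def)

lemma hom_gelt: "hom (gelt GA1) = a1" "hom (gelt GB1) = b1" "hom (gelt GA2) = a2" "hom (gelt GB2) = b2"
  "hom (gelt GC1) = b1 * U * b2" "hom (gelt GC2) = z"
  by (simp_all add: hom_mult lam_closed hom_lam PV3_gens_mem val_def mult.assoc inverses inverses')

end


section \<open>The two unipotent representations of the group\<close>

lemma wval_nth_0:
  fixes \<phi> \<psi> :: "'g \<Rightarrow> 'r::ring_1 fps"
  assumes "\<And>x. \<phi> x $ 0 = 1" "\<And>x. \<psi> x $ 0 = 1"
  shows "wval \<phi> \<psi> v $ 0 = 1"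
  by (induction v) (auto simp: wval_def fps_mult_nth_0' assms)

interpretation V: pv3_values "XR (Wz [])" "XR Wb1" "XR Wb2" "XR Wu" "rho False" "rho True"
  "uinv (XR (Wz []))" "uinv (XR Wb1)" "uinv (XR Wb2)" "uinv (XR Wu)" "uinv (rho False)" "uinv (rho True)"
  by unfold_locales (simp_all add: uinv rho(1) XR_rho_False XR_rho_True XR_rho_commute)

text \<open>With b1, b2, u and z sent to 1 every conjugation condition becomes trivial, so a1 and a2
  may be sent to free units.\<close>

interpretation F: pv3_values 1 1 1 1 "XR False" "XR True" 1 1 1 1 "uinv (XR False)" "uinv (XR True)"
  by unfold_locales (simp_all add: uinv)

lemma V_unipotent: "unipotent_rep PV3 V.hom"
proof
  show "V.hom x $ 0 = 1" if "x \<in> carrier PV3" for x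
    using that unfolding PV3_def presented_carrier
    by (auto simp: V.hom_class intro!: wval_nth_0)
      (simp_all add: V.val_def V.vinv_def fps_mult_nth_0' uinv rho)
qed (simp_all add: V.hom_mult V.hom_one)

lemma F_unipotent: "unipotent_rep PV3 F.hom"
proof
  show "F.hom x $ 0 = 1" if "x \<in> carrier PV3" for x
    using that unfolding PV3_def presented_carrier
    by (auto simp: F.hom_class intro!: wval_nth_0)
      (simp_all add: F.val_def F.vinv_def fps_mult_nth_0' uinv)
qed (simp_all add: F.hom_mult F.hom_one)

section \<open>Lie terms evaluated in the graded ring\<close>

definition gcls :: "gen \<Rightarrow> nat \<Rightarrow> (nat \<times> nat) word set set" where
  "gcls g = deg1_class PV3 (gelt g)"

lemma gcls_hel: "gcls g = PV3.hel 1 (gelt g)"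
  by (simp add: gcls_def PV3.deg1_class_eq_hel)

lemma gcls_closed: "gcls g \<in> lcarrier (assoc_graded PV3)"
  unfolding gcls_hel by (rule PV3.hel_closed) (simp add: gelt_closed)

text \<open>\<open>gr_rep\<close> respects all Lie operations, so its values on terms are determined
  in degree 1, where it reads off the linear coefficient.\<close>

lemma gr_rep_evr:
  assumes "unipotent_rep PV3 r"
  shows "unipotent_rep.gr_rep r (evr (assoc_graded PV3) gcls t) = ev (\<lambda>g. r (gelt g) $ Suc 0) t"
proof -
  interpret r: unipotent_rep PV3 r by (rule assms)
  have c: "evr (assoc_graded PV3) gcls t \<in> lcarrier (assoc_graded PV3)" for t
    using gcls_closed by (rule LG.evr_closed)
  have "r.gr_rep (gcls g) = r (gelt g) $ Suc 0" for g
    unfolding gcls_hel by (subst r.gr_rep_hel) (simp_all add: gelt_closed r.lead_def)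
  then show ?thesis
    by (induction t) (simp_all add: c r.gr_rep_zero r.gr_rep_add r.gr_rep_neg r.gr_rep_br)
qed

lemma evr_gcls_injective:
  assumes "evr (assoc_graded PV3) gcls s = evr (assoc_graded PV3) gcls t"
  shows "leq (LP (LN s) t) LZ"
proof (rule leq_if_represented_zero)
  have c: "evr (assoc_graded PV3) gcls t \<in> lcarrier (assoc_graded PV3)" for t
    using gcls_closed by (rule LG.evr_closed)
  have zero: "ev (\<lambda>g. r (gelt g) $ Suc 0) (LP (LN s) t) = 0" if "unipotent_rep PV3 r" for r :: "_ \<Rightarrow> 'w endo fps"
  proof -
    interpret r: unipotent_rep PV3 r by (rule that)
    have "evr (assoc_graded PV3) gcls (LP (LN s) t) = lzero (assoc_graded PV3)"
      using c by (simp add: assms LG.lneg_add)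
    then show ?thesis
      using gr_rep_evr [OF that, of "LP (LN s) t"] r.gr_rep_zero by simp
  qed
  \<comment> \<open>Linear coefficients add under products of series with constant term 1, and an
    inverse changes the sign; \<open>GC1\<close> thus gives b1 - u + b2.\<close>
  have "V.hom (gelt g) $ Suc 0 = (case wsplit g of Inl y \<Rightarrow> rho y $ Suc 0 | Inr s \<Rightarrow> ev RT s)" for g
    by (cases g) (simp_all add: V.hom_gelt fps_mult_nth_0' fps_mult_nth_1' uinv
        uinv_1 [unfolded One_nat_def] algebra_simps del: gelt.simps)
  then show "ev (\<lambda>g. case wsplit g of Inl y \<Rightarrow> rho y $ Suc 0 | Inr s \<Rightarrow> ev RT s) (LP (LN s) t) = 0"
    using zero [OF V_unipotent] by simp
  have "F.hom (gelt g) $ Suc 0 = (case wsplit g of Inl y \<Rightarrow> RT y | Inr s \<Rightarrow> 0)" for g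
    by (cases g) (simp_all add: F.hom_gelt del: gelt.simps)
  then show "ev (\<lambda>g. case wsplit g of Inl y \<Rightarrow> RT y | Inr s \<Rightarrow> 0) (LP (LN s) t) = 0"
    using zero [OF F_unipotent] by simp
qed

lemma generate_gelt: "generate PV3 (range gelt) = carrier PV3"
proof -
  let ?H = "generate PV3 (range gelt)"
  have sub: "range gelt \<subseteq> carrier PV3" using gelt_closed by auto
  interpret H: subgroup ?H PV3 by (rule PV3.generate_is_subgroup [OF sub])
  have gelt: "gelt g \<in> ?H" for g by (rule generate.incl) simp
  have c: "lam i j \<in> carrier PV3" if "i \<in> {1, 2, 3}" "j \<in> {1, 2, 3}" "i \<noteq> j" for i j
    using that by (rule lam_closed)
  have l13: "lam 1 3 \<in> ?H" using gelt [of GC2] by simp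
  have left: "x \<in> ?H" if "lam 1 3 \<otimes>\<^bsub>PV3\<^esub> x \<in> ?H" "x \<in> carrier PV3" for x
    using H.m_closed [OF H.m_inv_closed [OF l13] that(1)] that(2) c by simp
  have l31: "lam 3 1 \<in> ?H" using left [of "lam 3 1"] gelt [of GC1] c by simp
  have l23: "lam 2 3 \<in> ?H" using left [of "lam 2 3"] gelt [of GA1] c by simp
  have l12: "lam 1 2 \<in> ?H" using left [of "lam 1 2"] gelt [of GB1] c by simp
  have right: "x \<in> ?H" if "x \<otimes>\<^bsub>PV3\<^esub> lam 3 1 \<in> ?H" "x \<in> carrier PV3" for x
    using H.m_closed [OF that(1) H.m_inv_closed [OF l31]] that(2) c by (simp add: PV3.m_assoc)
  have l32: "lam 3 2 \<in> ?H" using right [of "lam 3 2"] gelt [of GA2] c by simp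
  have l21: "lam 2 1 \<in> ?H" using right [of "lam 2 1"] gelt [of GB2] c by simp
  have "gen_elem PV3_gens PV3_rels ` PV3_gens \<subseteq> ?H"
    using l13 l31 l23 l12 l32 l21 by (auto simp: PV3_gens_def lam_def)
  then have "generate PV3 (gen_elem PV3_gens PV3_rels ` PV3_gens) \<subseteq> ?H"
    by (intro PV3.generate_subgroup_incl H.subgroup_axioms)
  then have "carrier PV3 \<subseteq> ?H"
    unfolding PV3_def presented_generated .
  then show ?thesis using H.subset by blast
qed

lemma evr_gcls_surjective:
  assumes "f \<in> lcarrier (assoc_graded PV3)"
  shows "\<exists>t. evr (assoc_graded PV3) gcls t = f"
proof (rule PV3.assoc_graded_generated [OF assms _ generate_gelt])
  show "range gelt \<subseteq> carrier PV3" using gelt_closed by auto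
  show "\<exists>t. evr (assoc_graded PV3) gcls t = lzero (assoc_graded PV3)"
    by (rule exI [of _ LZ]) simp
  show "\<exists>t. evr (assoc_graded PV3) gcls t = PV3.hel 1 s" if "s \<in> range gelt" for s
    using that gcls_hel by (metis evr.simps(2) rangeE)
next
  show "\<exists>t. evr (assoc_graded PV3) gcls t = LG.lneg f" if "\<exists>t. evr (assoc_graded PV3) gcls t = f" for f
    using that evr.simps(3) by metis
  show "\<exists>t. evr (assoc_graded PV3) gcls t = ladd (assoc_graded PV3) f g"
    if "\<exists>t. evr (assoc_graded PV3) gcls t = f" "\<exists>t. evr (assoc_graded PV3) gcls t = g" for f g
    using that evr.simps(4) by metis
  show "\<exists>t. evr (assoc_graded PV3) gcls t = lbr (assoc_graded PV3) f g"
    if "\<exists>t. evr (assoc_graded PV3) gcls t = f" "\<exists>t. evr (assoc_graded PV3) gcls t = g" for f g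
    using that evr.simps(5) by metis
qed

text \<open>In [wy, b] = [w, b]^y [y, b] the first factor is trivial. A defining relation that makes
  two elements commute thereby becomes an equality of commutators.\<close>

lemma (in group) gcomm_eqI:
  assumes "w \<in> carrier G" "y \<in> carrier G" "b \<in> carrier G" "w \<otimes> b = b \<otimes> w" "x = w \<otimes> y"
  shows "gcomm G x b = gcomm G y b"
proof -
  have "gcomm G x b = inv y \<otimes> inv w \<otimes> inv b \<otimes> (w \<otimes> y) \<otimes> b"
    using assms by (simp add: gcomm_def inv_mult_group)
  also have "\<dots> = inv y \<otimes> inv (b \<otimes> w) \<otimes> w \<otimes> y \<otimes> b"
    using assms(1-3) by (simp add: m_assoc inv_mult_group)
  also have "\<dots> = gcomm G y b"
    using assms(1-3) by (simp add: word_simps flip: assms(4))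
  finally show ?thesis .
qed

text \<open>The last four come from the facts that a2 c1^-1 commutes with b1, b2 c1^-1 with a1,
  c1^-1 a1 with b2, and c1^-1 b1 with a2. In the latter two the commuting element relates c1^-1 to
  a1^-1 or b1^-1 by left multiplication, hence the commutators of inverses.\<close>

lemma gelt_relations:
  "gelt GA1 \<otimes>\<^bsub>PV3\<^esub> gelt GB1 = gelt GB1 \<otimes>\<^bsub>PV3\<^esub> gelt GA1"
  "gelt GA2 \<otimes>\<^bsub>PV3\<^esub> gelt GB2 = gelt GB2 \<otimes>\<^bsub>PV3\<^esub> gelt GA2"
  "gcomm PV3 (gelt GC1) (gelt GB1) = gcomm PV3 (gelt GA2) (gelt GB1)"
  "gcomm PV3 (gelt GC1) (gelt GA1) = gcomm PV3 (gelt GB2) (gelt GA1)"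
  "gcomm PV3 (inv\<^bsub>PV3\<^esub> (gelt GC1)) (gelt GB2) = gcomm PV3 (inv\<^bsub>PV3\<^esub> (gelt GA1)) (gelt GB2)"
  "gcomm PV3 (inv\<^bsub>PV3\<^esub> (gelt GC1)) (gelt GA2) = gcomm PV3 (inv\<^bsub>PV3\<^esub> (gelt GB1)) (gelt GA2)"
proof -
  define p q r s t v where "p = lam 1 2" and "q = lam 2 1" and "r = lam 1 3" and "s = lam 3 1"
    and "t = lam 2 3" and "v = lam 3 2"
  note defs = p_def q_def r_def s_def t_def v_def
  have c [simp]: "p \<in> carrier PV3" "q \<in> carrier PV3" "r \<in> carrier PV3" "s \<in> carrier PV3"
    "t \<in> carrier PV3" "v \<in> carrier PV3"
    by (simp_all add: defs lam_closed)
  have gelt: "gelt GA1 = r \<otimes>\<^bsub>PV3\<^esub> t" "gelt GB1 = r \<otimes>\<^bsub>PV3\<^esub> p" "gelt GA2 = v \<otimes>\<^bsub>PV3\<^esub> s"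
    "gelt GB2 = q \<otimes>\<^bsub>PV3\<^esub> s" "gelt GC1 = r \<otimes>\<^bsub>PV3\<^esub> s"
    by (simp_all add: defs)
  have rel: "p \<otimes>\<^bsub>PV3\<^esub> r \<otimes>\<^bsub>PV3\<^esub> t = t \<otimes>\<^bsub>PV3\<^esub> r \<otimes>\<^bsub>PV3\<^esub> p"
    "r \<otimes>\<^bsub>PV3\<^esub> p \<otimes>\<^bsub>PV3\<^esub> v = v \<otimes>\<^bsub>PV3\<^esub> p \<otimes>\<^bsub>PV3\<^esub> r"
    "q \<otimes>\<^bsub>PV3\<^esub> t \<otimes>\<^bsub>PV3\<^esub> r = r \<otimes>\<^bsub>PV3\<^esub> t \<otimes>\<^bsub>PV3\<^esub> q"
    "t \<otimes>\<^bsub>PV3\<^esub> q \<otimes>\<^bsub>PV3\<^esub> s = s \<otimes>\<^bsub>PV3\<^esub> q \<otimes>\<^bsub>PV3\<^esub> t"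
    "s \<otimes>\<^bsub>PV3\<^esub> v \<otimes>\<^bsub>PV3\<^esub> p = p \<otimes>\<^bsub>PV3\<^esub> v \<otimes>\<^bsub>PV3\<^esub> s"
    "v \<otimes>\<^bsub>PV3\<^esub> s \<otimes>\<^bsub>PV3\<^esub> q = q \<otimes>\<^bsub>PV3\<^esub> s \<otimes>\<^bsub>PV3\<^esub> v"
    unfolding defs by (rule lam_relation; auto)+
  show "gelt GA1 \<otimes>\<^bsub>PV3\<^esub> gelt GB1 = gelt GB1 \<otimes>\<^bsub>PV3\<^esub> gelt GA1"
    using arg_cong [OF rel(1), of "\<lambda>x. r \<otimes>\<^bsub>PV3\<^esub> x"] by (simp add: gelt PV3.m_assoc del: gelt.simps)
  show "gelt GA2 \<otimes>\<^bsub>PV3\<^esub> gelt GB2 = gelt GB2 \<otimes>\<^bsub>PV3\<^esub> gelt GA2"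
    using arg_cong [OF rel(6), of "\<lambda>x. x \<otimes>\<^bsub>PV3\<^esub> s"] by (simp add: gelt PV3.m_assoc del: gelt.simps)
  show "gcomm PV3 (gelt GC1) (gelt GB1) = gcomm PV3 (gelt GA2) (gelt GB1)"
    using arg_cong [OF rel(2), of "\<lambda>x. x \<otimes>\<^bsub>PV3\<^esub> inv\<^bsub>PV3\<^esub> r"]
    by (intro PV3.gcomm_eqI [where w = "v \<otimes>\<^bsub>PV3\<^esub> inv\<^bsub>PV3\<^esub> r", THEN HOL.sym])
      (simp_all add: gelt PV3.m_assoc del: gelt.simps)
  show "gcomm PV3 (gelt GC1) (gelt GA1) = gcomm PV3 (gelt GB2) (gelt GA1)"
    using arg_cong [OF rel(3), of "\<lambda>x. x \<otimes>\<^bsub>PV3\<^esub> inv\<^bsub>PV3\<^esub> r"]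
    by (intro PV3.gcomm_eqI [where w = "q \<otimes>\<^bsub>PV3\<^esub> inv\<^bsub>PV3\<^esub> r", THEN HOL.sym])
      (simp_all add: gelt PV3.m_assoc del: gelt.simps)
  show "gcomm PV3 (inv\<^bsub>PV3\<^esub> (gelt GC1)) (gelt GB2) = gcomm PV3 (inv\<^bsub>PV3\<^esub> (gelt GA1)) (gelt GB2)"
    using arg_cong [OF rel(4), of "\<lambda>x. inv\<^bsub>PV3\<^esub> s \<otimes>\<^bsub>PV3\<^esub> x"]
    by (intro PV3.gcomm_eqI [where w = "inv\<^bsub>PV3\<^esub> s \<otimes>\<^bsub>PV3\<^esub> t"])
      (simp_all add: gelt PV3.m_assoc PV3.inv_mult_group del: gelt.simps)
  show "gcomm PV3 (inv\<^bsub>PV3\<^esub> (gelt GC1)) (gelt GA2) = gcomm PV3 (inv\<^bsub>PV3\<^esub> (gelt GB1)) (gelt GA2)"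
    using arg_cong [OF rel(5), of "\<lambda>x. inv\<^bsub>PV3\<^esub> s \<otimes>\<^bsub>PV3\<^esub> x"]
    by (intro PV3.gcomm_eqI [where w = "inv\<^bsub>PV3\<^esub> s \<otimes>\<^bsub>PV3\<^esub> p"])
      (simp_all add: gelt PV3.m_assoc PV3.inv_mult_group del: gelt.simps)
qed

lemma gcls_relations:
  "PV3_lie_rels (assoc_graded PV3) (gcls GA1) (gcls GB1) (gcls GA2) (gcls GB2) (gcls GC1) (gcls GC2)"
proof -
  have br: "lbr (assoc_graded PV3) (PV3.hel 1 x) (PV3.hel 1 y) = PV3.hel 2 (gcomm PV3 x y)"
    if "x \<in> carrier PV3" "y \<in> carrier PV3" for x y
    using that PV3.hel_bracket [of x 1 y 1] by (simp add: numeral_2_eq_2)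
  have comm: "lbr (assoc_graded PV3) (gcls g) (gcls h) = lzero (assoc_graded PV3)"
    if "gelt g \<otimes>\<^bsub>PV3\<^esub> gelt h = gelt h \<otimes>\<^bsub>PV3\<^esub> gelt g" for g h
  proof -
    have "gcomm PV3 (gelt g) (gelt h) = inv\<^bsub>PV3\<^esub> (gelt h \<otimes>\<^bsub>PV3\<^esub> gelt g) \<otimes>\<^bsub>PV3\<^esub> (gelt g \<otimes>\<^bsub>PV3\<^esub> gelt h)"
      by (simp add: gcomm_def gelt_closed PV3.m_assoc PV3.inv_mult_group del: gelt.simps)
    then have "gcomm PV3 (gelt g) (gelt h) = \<one>\<^bsub>PV3\<^esub>"
      by (simp add: that gelt_closed del: gelt.simps)
    then show ?thesis by (simp add: gcls_hel br gelt_closed PV3.hel_one del: gelt.simps One_nat_def)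
  qed
  have eq: "lbr (assoc_graded PV3) (gcls g) (gcls h) = lbr (assoc_graded PV3) (gcls g') (gcls h)"
    if "gcomm PV3 (gelt g) (gelt h) = gcomm PV3 (gelt g') (gelt h)" for g g' h
    using that by (simp add: gcls_hel br gelt_closed del: gelt.simps One_nat_def)
  \<comment> \<open>Inverting the first argument becomes negation in the graded ring, and the
    negations on the two sides cancel.\<close>
  have eq': "lbr (assoc_graded PV3) (gcls g) (gcls h) = lbr (assoc_graded PV3) (gcls g') (gcls h)"
    if "gcomm PV3 (inv\<^bsub>PV3\<^esub> (gelt g)) (gelt h) = gcomm PV3 (inv\<^bsub>PV3\<^esub> (gelt g')) (gelt h)" for g g' h
  proof (rule LG.lneg_inject)
    have neg: "LG.lneg (lbr (assoc_graded PV3) (gcls g) (gcls h)) =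
        PV3.hel 2 (gcomm PV3 (inv\<^bsub>PV3\<^esub> (gelt g)) (gelt h))" for g h
    proof -
      have "LG.lneg (lbr (assoc_graded PV3) (gcls g) (gcls h)) = lbr (assoc_graded PV3) (LG.lneg (gcls g)) (gcls h)"
        by (simp add: LG.lbr_neg_left gcls_closed)
      also have "LG.lneg (gcls g) = PV3.hel 1 (inv\<^bsub>PV3\<^esub> (gelt g))"
        unfolding gcls_hel by (rule PV3.hel_inv [THEN HOL.sym]) (simp add: gelt_closed)
      finally show ?thesis by (simp add: gcls_hel br gelt_closed del: gelt.simps One_nat_def)
    qed
    show "LG.lneg (lbr (assoc_graded PV3) (gcls g) (gcls h)) = LG.lneg (lbr (assoc_graded PV3) (gcls g') (gcls h))"
      using that by (simp add: neg)
  qed (simp_all add: LG.lbr_closed gcls_closed)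
  show ?thesis
    unfolding PV3_lie_rels_def
    by (intro conjI comm eq gelt_relations eq' [OF gelt_relations(5)] eq' [OF gelt_relations(6)])
qed

text \<open>The presentation is expressed by its universal property: a choice of six elements
  satisfying the relations extends uniquely to a homomorphism, into Lie rings over an arbitrary
  type.\<close>

theorem theorem5p1:
  fixes M :: "'m liering"
  defines "LG \<equiv> assoc_graded PV3"
      and "A1 \<equiv> deg1_class PV3 (lam 1 3 \<otimes>\<^bsub>PV3\<^esub> lam 2 3)"
      and "B1 \<equiv> deg1_class PV3 (lam 1 3 \<otimes>\<^bsub>PV3\<^esub> lam 1 2)"
      and "A2 \<equiv> deg1_class PV3 (lam 3 2 \<otimes>\<^bsub>PV3\<^esub> lam 3 1)"
      and "B2 \<equiv> deg1_class PV3 (lam 2 1 \<otimes>\<^bsub>PV3\<^esub> lam 3 1)"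
      and "C1 \<equiv> deg1_class PV3 (lam 1 3 \<otimes>\<^bsub>PV3\<^esub> lam 3 1)"
      and "C2 \<equiv> deg1_class PV3 (lam 1 3)"
  shows "lie_ring LG
    \<and> {A1, B1, A2, B2, C1, C2} \<subseteq> lcarrier LG
    \<and> PV3_lie_rels LG A1 B1 A2 B2 C1 C2
    \<and> (\<forall>a1 b1 a2 b2 c1 c2.
          lie_ring M \<and> {a1, b1, a2, b2, c1, c2} \<subseteq> lcarrier M
          \<and> PV3_lie_rels M a1 b1 a2 b2 c1 c2 \<longrightarrow>
          (\<exists>h. lie_hom LG M h \<and> h A1 = a1 \<and> h B1 = b1 \<and> h A2 = a2 \<and> h B2 = b2
                \<and> h C1 = c1 \<and> h C2 = c2
                \<and> (\<forall>h'. lie_hom LG M h' \<and> h' A1 = a1 \<and> h' B1 = b1 \<and> h' A2 = a2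
                        \<and> h' B2 = b2 \<and> h' C1 = c1 \<and> h' C2 = c2
                        \<longrightarrow> (\<forall>x\<in>lcarrier LG. h' x = h x))))"
proof -
  have cls: "A1 = gcls GA1" "B1 = gcls GB1" "A2 = gcls GA2" "B2 = gcls GB2" "C1 = gcls GC1" "C2 = gcls GC2"
    by (simp_all add: gcls_def A1_def B1_def A2_def B2_def C1_def C2_def)
  have univ: "\<exists>h. lie_hom LG M h \<and> (\<forall>g. h (gcls g) = m g) \<and>
      (\<forall>h'. lie_hom LG M h' \<and> (\<forall>g. h' (gcls g) = m g) \<longrightarrow> (\<forall>x\<in>lcarrier LG. h' x = h x))"
    if M: "lie_ring M" and m: "\<And>g. m g \<in> lcarrier M"
      and rels: "PV3_lie_rels M (m GA1) (m GB1) (m GA2) (m GB2) (m GC1) (m GC2)" for m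
  proof -
    interpret M: bilinear_ring M using M by (rule lie_ring_bilinear)
    have c: "evr LG gcls t \<in> lcarrier LG" for t
      unfolding LG_def using gcls_closed by (rule LG.evr_closed)
    have cM: "evr M m t \<in> lcarrier M" for t using m by (rule M.evr_closed)
    \<comment> \<open>A term is chosen for each element. Terms with equal values in the graded ring
      differ by a consequence of the relators, which vanishes in \<open>M\<close>, so the choice
      does not matter.\<close>
    define h where "h x = evr M m (SOME t. evr LG gcls t = x)" for x
    have h_evr: "h (evr LG gcls t) = evr M m t" for t
    proof -
      define s where "s = (SOME s. evr LG gcls s = evr LG gcls t)"
      have "evr LG gcls s = evr LG gcls t" unfolding s_def by (rule someI) (rule HOL.refl)
      then have "leq (LP (LN s) t) LZ" unfolding LG_def by (rule evr_gcls_injective)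
      then have "evr M m (LP (LN s) t) = evr M m LZ" by (rule leq_sound [OF M m rels])
      then have "M.lneg (evr M m s) = M.lneg (evr M m t)"
        using cM by (intro M.lneg_eqI) (simp_all add: M.lneg_closed)
      then have "evr M m s = evr M m t" using cM M.lneg_inject by blast
      then show ?thesis by (simp add: h_def s_def)
    qed
    have surj: "\<exists>t. x = evr LG gcls t" if "x \<in> lcarrier LG" for x
      using evr_gcls_surjective that unfolding LG_def by blast
    have hom: "lie_hom LG M h"
      unfolding lie_hom_def
    proof (intro conjI ballI)
      fix x assume "x \<in> lcarrier LG"
      then obtain s where s: "x = evr LG gcls s" using surj by blast
      show "h x \<in> lcarrier M" by (simp add: s h_evr cM)
      fix y assume "y \<in> lcarrier LG"
      then obtain t where t: "y = evr LG gcls t" using surj by blast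
      show "h (ladd LG x y) = ladd M (h x) (h y)"
        using h_evr [of "LP s t"] by (simp add: s t h_evr)
      show "h (lbr LG x y) = lbr M (h x) (h y)"
        using h_evr [of "LB s t"] by (simp add: s t h_evr)
    qed
    moreover have "h (gcls g) = m g" for g
      using h_evr [of "LV g"] by simp
    moreover have "h' x = h x"
      if h': "lie_hom LG M h'" "\<forall>g. h' (gcls g) = m g" and "x \<in> lcarrier LG" for h' x
    proof -
      obtain t where t: "x = evr LG gcls t" using surj \<open>x \<in> _\<close> by blast
      have "h' x = evr M (\<lambda>g. h' (gcls g)) t"
        unfolding t LG_def
        by (rule hom_evr [OF LG.bilinear_ring_axioms M.bilinear_ring_axioms h'(1) [unfolded LG_def] gcls_closed])
      then show ?thesis using h'(2) by (simp add: t h_evr)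
    qed
    ultimately show ?thesis by blast
  qed
  show ?thesis
  proof (intro conjI allI impI)
    show "lie_ring LG" unfolding LG_def by (rule PV3.lie_ring_assoc_graded)
    show "{A1, B1, A2, B2, C1, C2} \<subseteq> lcarrier LG" unfolding cls LG_def using gcls_closed by blast
    show "PV3_lie_rels LG A1 B1 A2 B2 C1 C2" unfolding cls LG_def by (rule gcls_relations)
    fix a1 b1 a2 b2 c1 c2
    assume *: "lie_ring M \<and> {a1, b1, a2, b2, c1, c2} \<subseteq> lcarrier M \<and> PV3_lie_rels M a1 b1 a2 b2 c1 c2"
    define m where "m g = (case g of GA1 \<Rightarrow> a1 | GB1 \<Rightarrow> b1 | GA2 \<Rightarrow> a2 | GB2 \<Rightarrow> b2 | GC1 \<Rightarrow> c1 | GC2 \<Rightarrow> c2)" for g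
    have m: "m GA1 = a1" "m GB1 = b1" "m GA2 = a2" "m GB2 = b2" "m GC1 = c1" "m GC2 = c2"
      by (simp_all add: m_def)
    have all: "(\<forall>g. h (gcls g) = m g) \<longleftrightarrow> h A1 = a1 \<and> h B1 = b1 \<and> h A2 = a2 \<and> h B2 = b2 \<and> h C1 = c1 \<and> h C2 = c2" for h
      unfolding cls m [symmetric] by (metis gen.exhaust)
    have "m g \<in> lcarrier M" for g using * by (cases g) (simp_all add: m_def)
    from univ [of m, OF _ this] show "\<exists>h. lie_hom LG M h \<and> h A1 = a1 \<and> h B1 = b1 \<and> h A2 = a2 \<and> h B2 = b2
        \<and> h C1 = c1 \<and> h C2 = c2
        \<and> (\<forall>h'. lie_hom LG M h' \<and> h' A1 = a1 \<and> h' B1 = b1 \<and> h' A2 = a2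
                \<and> h' B2 = b2 \<and> h' C1 = c1 \<and> h' C2 = c2
                \<longrightarrow> (\<forall>x\<in>lcarrier LG. h' x = h x))"
      unfolding m all using * by (simp only: conj_assoc)
  qed
qed

end
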